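(* Let $\Phi=\{\phi_1,\ldots,\phi_n\}$ be a finite set of compactly supported functions on $\mathbb{R}$, let $V_\Phi$ be the shift-invariant space generated by $\Phi$, and let $H\subseteq V_\Phi$ be the space of all analytic functions in $V_\Phi$. Then there exist $s\in\mathbb{N}$, $\lambda_j\in\mathbb{C}$ (pairwise distinct modulo $2\pi i$), $d_j\in\mathbb{N}_0$, $1$-periodic analytic functions $\pi_{j,k}:\mathbb{R}\to\mathbb{C}$, $k=0,\ldots,d_j$, and subspaces $N_j\subset M_{d_j}$, $j=1,\ldots,s$, each $N_j$ being an invariant subspace of the block-diagonal matrix (linear operator) $A_{d_j}$, such that $H$ is the linear span of the spaces $L_1,\ldots,L_s$ with $$L_j=\Bigl\{\,e^{\lambda_j t}\sum_{k=0}^{d_j}p_{j,k}(t)\,\pi_{j,k}(t)\ \Bigl|\ p_{j,k}\in\mathcal{P}_k,\ (p_{j,0},\ldots,p_{j,d_j})\in N_j\Bigr\},\qquad j=1,\ldots,s.$$ Moreover, every subspace of $H$ has the same form, with the same $\lambda_j$ and $\pi_{j,k}$ but with some subspaces $N_j'\subset N_j$, $j=1,\ldots,s$, in place of $N_j$.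
   Context: $\ell(\mathbb{Z})$ denotes the space of sequences over $\mathbb{C}$ indexed by $\mathbb{Z}$. The shift-invariant space generated by $\Phi$ is $$V_\Phi=\operatorname{closure}\Bigl\{\sum_{j=1}^n\sum_{k\in\mathbb{Z}}c(j,k)\,\phi_j(\cdot-k)\ :\ c(j,\cdot)\in\ell(\mathbb{Z})\Bigr\}.$$ A function on $\mathbb{R}$ is called analytic if it is infinitely differentiable on $\mathbb{R}$ and has a power series expansion around each point of $\mathbb{R}$. $\mathcal{P}_k$ is the space of algebraic polynomials of degree at most $k$. For $d\in\mathbb{N}_0$, $M_d=\bigoplus_{k=0}^d\mathcal{P}_k$ is the direct sum of these spaces, and $A_d:M_d\to M_d$ is the linear operator $$A_d(p_0,\ldots,p_d)=\bigl(p_0(\cdot+1),\ldots,p_d(\cdot+1)\bigr).$$ Its matrix is block-diagonal with blocks $B_0,\ldots,B_d$, where $B_k$ is the matrix of size $k+1$ that maps the vector of coefficients of $p_k\in\mathcal{P}_k$ to the vector of coefficients of $p_k(\cdot+1)$.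
   Formalization: "Every subspace of H" is restricted to every subspace invariant under integer shifts; otherwise it is false: for Φ={e^t 1_[0,1), e^{2t} 1_[0,1)}, the subspace span{e^t+e^{2t}} of H is not shift-invariant, so it is not of the stated form. *)

theory Defs
  imports
    "HOL-Analysis.Analysis"
    "HOL-Computational_Algebra.Polynomial"
    "HOL-Library.Function_Algebras"
    "HOL-Library.Periodic_Fun"
begin

definition scale_fun :: "complex \<Rightarrow> (real \<Rightarrow> complex) \<Rightarrow> real \<Rightarrow> complex"
  where "scale_fun c f = (\<lambda>t. c * f t)"

definition scale_tuple :: "complex \<Rightarrow> (nat \<Rightarrow> complex poly) \<Rightarrow> nat \<Rightarrow> complex poly"
  where "scale_tuple c p = (\<lambda>k. smult c (p k))"

global_interpretation cfun: vector_space scale_fun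
  by unfold_locales (auto simp: scale_fun_def fun_eq_iff algebra_simps)

global_interpretation ctuple: vector_space scale_tuple
  by unfold_locales (auto simp: scale_tuple_def fun_eq_iff smult_add_right smult_add_left)

definition compactly_supported :: "(real \<Rightarrow> complex) \<Rightarrow> bool"
  where "compactly_supported f \<longleftrightarrow> compact (closure (support_on UNIV f))"

text \<open>
  For compactly supported generators the sum over the integers has, at every point, only finitely
  many nonzero terms. The closure is the one for pointwise convergence (the product topology on
  functions). The set of all sums is already closed in that topology (it is the image of a power of
  the complex numbers under a continuous linear map between such powers), so any finer topology,
  such as uniform convergence on compact sets, yields the same space.
\<close>

definition shift_invariant_space :: "nat \<Rightarrow> (nat \<Rightarrow> real \<Rightarrow> complex) \<Rightarrow> (real \<Rightarrow> complex) set"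
  where "shift_invariant_space n \<phi> =
    closure {\<lambda>t. \<Sum>j=1..n. \<Sum>\<^sub>\<infinity>k\<in>UNIV. c j k * \<phi> j (t - of_int k) | c :: nat \<Rightarrow> int \<Rightarrow> complex. True}"

definition infinitely_differentiable :: "(real \<Rightarrow> complex) \<Rightarrow> bool"
  where "infinitely_differentiable f \<longleftrightarrow>
    (\<exists>D :: nat \<Rightarrow> real \<Rightarrow> complex. D 0 = f \<and>
      (\<forall>m t. (D m has_vector_derivative D (Suc m) t) (at t)))"

definition real_analytic :: "(real \<Rightarrow> complex) \<Rightarrow> bool"
  where "real_analytic f \<longleftrightarrow> infinitely_differentiable f \<and>
    (\<forall>x. \<exists>r>0. \<exists>a :: nat \<Rightarrow> complex. \<forall>t. \<bar>t - x\<bar> < r \<longrightarrow>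
      (\<lambda>m. a m * of_real (t - x) ^ m) sums f t)"

text \<open>
  The direct sum of the spaces of polynomials of degree at most 0, ..., d: a tuple
  (p 0, ..., p d) is extended by zero to a function on all natural numbers.
\<close>

definition poly_tuples :: "nat \<Rightarrow> (nat \<Rightarrow> complex poly) set"
  where "poly_tuples d = {p. (\<forall>k\<le>d. degree (p k) \<le> k) \<and> (\<forall>k>d. p k = 0)}"

text \<open>Composition with \<open>[:1, 1:]\<close> replaces each polynomial by its shift by 1.\<close>

definition tuple_shift :: "(nat \<Rightarrow> complex poly) \<Rightarrow> nat \<Rightarrow> complex poly"
  where "tuple_shift p = (\<lambda>k. pcompose (p k) [:1, 1:])"

definition invariant_tuple_subspace :: "nat \<Rightarrow> (nat \<Rightarrow> complex poly) set \<Rightarrow> bool"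
  where "invariant_tuple_subspace d N \<longleftrightarrow>
    N \<subseteq> poly_tuples d \<and> ctuple.subspace N \<and> tuple_shift ` N \<subseteq> N"

definition exp_poly_space ::
    "complex \<Rightarrow> nat \<Rightarrow> (nat \<Rightarrow> real \<Rightarrow> complex) \<Rightarrow> (nat \<Rightarrow> complex poly) set \<Rightarrow> (real \<Rightarrow> complex) set"
  where "exp_poly_space \<mu> d \<pi> N =
    {\<lambda>t. exp (\<mu> * of_real t) * (\<Sum>k=0..d. poly (p k) (of_real t) * \<pi> k t) | p. p \<in> N}"

definition shift_invariant :: "(real \<Rightarrow> complex) set \<Rightarrow> bool"
  where "shift_invariant U \<longleftrightarrow> (\<forall>f\<in>U. \<forall>k::int. (\<lambda>t. f (t - of_int k)) \<in> U)"

end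

theory Submission
  imports Defs "HOL-Complex_Analysis.Complex_Analysis"
    "HOL-Computational_Algebra.Polynomial_Factorial"
    "HOL-Computational_Algebra.Field_as_Ring"
    "HOL-Computational_Algebra.Fundamental_Theorem_Algebra"
begin

text \<open>
  The space \<open>H\<close> of analytic functions is finite-dimensional, and the unit shift acts on it; the
  theorem is the decomposition of \<open>H\<close> into generalized eigenspaces of this operator.

  Finite dimension. On the interval \<open>(0,1)\<close> only finitely many translates of the generators are
  nonzero, so finitely many nodes in \<open>(0,1)\<close> determine every sum of translates there
  (\<open>finite_interpolation_nodes\<close>). This is expressed by linear identities between values at finitely
  many points, hence it survives the pointwise closure. An analytic function that vanishes on
  \<open>(0,1)\<close> vanishes everywhere (\<open>real_analytic_eq_0\<close>), so the values at the nodes give linear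
  coordinates on \<open>H\<close>.

  Decomposition. Some polynomial \<open>Q\<close> with \<open>Q(0) \<noteq> 0\<close> satisfies \<open>Q(S) = 0\<close> on \<open>H\<close>, where \<open>S\<close> is the
  unit shift (\<open>annihilating_polynomial\<close>). Factoring \<open>Q\<close> and using Bezout identities splits every
  shift-invariant subspace of \<open>H\<close> into its intersections with the spaces \<open>ker (S - z)^m\<close>, for the
  roots \<open>z\<close> of \<open>Q\<close> (\<open>primary_decomposition\<close>). With \<open>z = exp \<mu>\<close>, each element of such a kernel is
  \<open>exp (\<mu> t)\<close> times a combination of binomial polynomials \<open>t gchoose i\<close>, \<open>i < m\<close>, with 1-periodic
  analytic coefficients (\<open>generalized_eigenfunction_expansion\<close>). Finitely many periodic functions
  suffice for a spanning set of the kernel. Giving them only positions \<open>k \<ge> m\<close> in the tuple, and 0 to the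
  other positions, makes the constraint that the \<open>k\<close>-th polynomial has degree at most \<open>k\<close> harmless
  (\<open>pack_into_tuple\<close>).

  The tuple spaces. For a shift-invariant subspace \<open>U\<close> of \<open>H\<close>, let \<open>N j\<close> consist of all polynomial
  tuples whose function, formed with \<open>\<mu> j\<close> and \<open>\<pi> j\<close>, lies in \<open>U\<close>. These tuples form an invariant
  subspace because shifting a tuple shifts the function, up to the factor \<open>exp (- \<mu> j)\<close>. Both the
  description of \<open>H\<close> and the one of its subspaces are instances of this construction
  (\<open>span_exp_poly_spaces\<close>), and it is monotone in \<open>U\<close>.
\<close>

section \<open>Analytic functions on the real line\<close>

text \<open>
  Analyticity of a function of a real variable, expressed through local holomorphic extensions. In
  this form closure under products and translations and the identity theorem reduce to the
  corresponding facts about holomorphic functions.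
\<close>

definition locally_holomorphic :: "(real \<Rightarrow> complex) \<Rightarrow> bool"
  where "locally_holomorphic f \<longleftrightarrow>
    (\<forall>x. \<exists>r>0. \<exists>F. F holomorphic_on ball (of_real x) r \<and> (\<forall>t. \<bar>t - x\<bar> < r \<longrightarrow> f t = F (of_real t)))"

lemma of_real_in_ball_iff: "complex_of_real t \<in> ball (of_real x) r \<longleftrightarrow> \<bar>t - x\<bar> < r"
  by (simp add: dist_commute dist_real_def)

text \<open>
  The derivative of a local holomorphic extension extends the derivative, so the property passes to
  derivatives. Iterating this gives infinite differentiability.
\<close>

lemma locally_holomorphic_has_derivative:
  assumes "locally_holomorphic f"
  shows "\<exists>g. locally_holomorphic g \<and> (\<forall>t. (f has_vector_derivative g t) (at t))"
proof -
  have deriv_at: "(f has_vector_derivative deriv F (of_real t)) (at t)"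
    if F: "F holomorphic_on ball (of_real x) r" and eq: "\<forall>t. \<bar>t - x\<bar> < r \<longrightarrow> f t = F (of_real t)"
      and t: "\<bar>t - x\<bar> < r" for F x r t
  proof -
    have "(F has_field_derivative deriv F (of_real t)) (at (of_real t))"
      using F t holomorphic_derivI open_ball of_real_in_ball_iff by blast
    then have "((\<lambda>t. F (of_real t)) has_vector_derivative deriv F (of_real t)) (at t)"
      by (simp add: has_vector_derivative_real_field)
    then show ?thesis
    proof (rule has_vector_derivative_transform_within_open)
      show "open {x - r<..<x + r}" "t \<in> {x - r<..<x + r}"
        using t by auto
    qed (use eq in auto)
  qed
  have "locally_holomorphic (\<lambda>t. vector_derivative f (at t))"
    unfolding locally_holomorphic_def
  proof
    fix x
    obtain r F where "r > 0" "F holomorphic_on ball (of_real x) r"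
      "\<forall>t. \<bar>t - x\<bar> < r \<longrightarrow> f t = F (of_real t)"
      using assms unfolding locally_holomorphic_def by blast
    then show "\<exists>r>0. \<exists>F. F holomorphic_on ball (of_real x) r \<and>
        (\<forall>t. \<bar>t - x\<bar> < r \<longrightarrow> vector_derivative f (at t) = F (of_real t))"
      by (intro exI[of _ r] conjI exI[of _ "deriv F"] allI impI vector_derivative_at deriv_at[of F x r])
        (auto intro: holomorphic_deriv)
  qed
  moreover have "(f has_vector_derivative vector_derivative f (at t)) (at t)" for t
  proof -
    obtain r F where "r > 0" "F holomorphic_on ball (of_real t) r"
      "\<forall>s. \<bar>s - t\<bar> < r \<longrightarrow> f s = F (of_real s)"
      using assms unfolding locally_holomorphic_def by blast
    then show ?thesis
      using deriv_at[of F t r t] by (simp add: vector_derivative_at)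
  qed
  ultimately show ?thesis by blast
qed

text \<open>
  A power series that converges on a real interval converges on the complex disc with the same
  centre and radius, and a holomorphic function has a Taylor series on every disc in its domain.
\<close>

lemma real_analytic_iff_locally_holomorphic:
  "real_analytic f \<longleftrightarrow> locally_holomorphic f"
proof
  assume f: "real_analytic f"
  show "locally_holomorphic f"
    unfolding locally_holomorphic_def
  proof
    fix x
    obtain r a where r: "r > 0"
      and a: "\<And>t. \<bar>t - x\<bar> < r \<Longrightarrow> (\<lambda>m. a m * of_real (t - x) ^ m) sums f t"
      using f unfolding real_analytic_def by blast
    define F where "F z = (\<Sum>m. a m * (z - of_real x) ^ m)" for z
    have "F holomorphic_on ball (of_real x) r"
    proof (rule power_series_holomorphic)
      fix w :: complex assume w: "w \<in> ball (of_real x) r"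
      obtain s where s: "norm (w - of_real x) < s" "s < r"
        using w dense[of "norm (w - of_real x)" r] by (auto simp: dist_norm norm_minus_commute)
      have "0 \<le> norm (w - of_real x)" by simp
      with s have "s > 0" by linarith
      have "summable (\<lambda>m. a m * of_real s ^ m)"
        using a[of "x + s"] s \<open>s > 0\<close> by (auto simp: sums_iff)
      then have "summable (\<lambda>m. a m * (w - of_real x) ^ m)"
        by (rule powser_inside) (use s \<open>s > 0\<close> in auto)
      then show "(\<lambda>m. a m * (w - of_real x) ^ m) sums F w"
        unfolding F_def by (rule summable_sums)
    qed
    moreover have "f t = F (of_real t)" if "\<bar>t - x\<bar> < r" for t
      using a[OF that] by (simp add: F_def sums_iff)
    ultimately show "\<exists>r>0. \<exists>F. F holomorphic_on ball (of_real x) r \<and>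
        (\<forall>t. \<bar>t - x\<bar> < r \<longrightarrow> f t = F (of_real t))"
      using r by (intro exI[of _ r] conjI exI[of _ F]) auto
  qed
next
  assume f: "locally_holomorphic f"
  obtain d where d: "\<And>g. locally_holomorphic g \<Longrightarrow>
      locally_holomorphic (d g) \<and> (\<forall>t. (g has_vector_derivative d g t) (at t))"
    using locally_holomorphic_has_derivative by metis
  have "locally_holomorphic ((d ^^ m) f)" for m
    by (induction m) (use f d in auto)
  then have "infinitely_differentiable f"
    unfolding infinitely_differentiable_def
    by (intro exI[of _ "\<lambda>m. (d ^^ m) f"]) (use d in auto)
  moreover have "\<exists>r>0. \<exists>a. \<forall>t. \<bar>t - x\<bar> < r \<longrightarrow> (\<lambda>m. a m * of_real (t - x) ^ m) sums f t" for x
  proof -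
    obtain r F where r: "r > 0" and F: "F holomorphic_on ball (of_real x) r"
      and eq: "\<forall>t. \<bar>t - x\<bar> < r \<longrightarrow> f t = F (of_real t)"
      using f unfolding locally_holomorphic_def by blast
    have "(\<lambda>m. (deriv ^^ m) F (of_real x) / fact m * of_real (t - x) ^ m) sums f t"
      if "\<bar>t - x\<bar> < r" for t
      using holomorphic_power_series[OF F of_real_in_ball_iff[THEN iffD2, OF that]] eq that by simp
    then show ?thesis
      using r by (intro exI[of _ r] conjI exI[of _ "\<lambda>m. (deriv ^^ m) F (of_real x) / fact m"]) auto
  qed
  ultimately show "real_analytic f"
    by (simp add: real_analytic_def)
qed

lemma real_analytic_entire:
  assumes "F holomorphic_on UNIV"
  shows "real_analytic (\<lambda>t. F (of_real t))"
  unfolding real_analytic_iff_locally_holomorphic locally_holomorphic_def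
  using holomorphic_on_subset[OF assms subset_UNIV]
  by (intro allI exI[of _ 1] exI[of _ F]) auto

lemma real_analytic_binop:
  assumes op: "\<And>F G S. \<lbrakk>F holomorphic_on S; G holomorphic_on S\<rbrakk> \<Longrightarrow> (\<lambda>z. b (F z) (G z)) holomorphic_on S"
    and "real_analytic f" "real_analytic g"
  shows "real_analytic (\<lambda>t. b (f t) (g t))"
  unfolding real_analytic_iff_locally_holomorphic locally_holomorphic_def
proof
  fix x
  obtain r F where F: "r > 0" "F holomorphic_on ball (of_real x) r"
    "\<forall>t. \<bar>t - x\<bar> < r \<longrightarrow> f t = F (of_real t)"
    using assms(2) unfolding real_analytic_iff_locally_holomorphic locally_holomorphic_def by blast
  obtain q G where G: "q > 0" "G holomorphic_on ball (of_real x) q"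
    "\<forall>t. \<bar>t - x\<bar> < q \<longrightarrow> g t = G (of_real t)"
    using assms(3) unfolding real_analytic_iff_locally_holomorphic locally_holomorphic_def by blast
  have "(\<lambda>z. b (F z) (G z)) holomorphic_on ball (of_real x) (min r q)"
    by (intro op) (use F(2) G(2) holomorphic_on_subset in \<open>fastforce intro: subset_ball\<close>)+
  then show "\<exists>p>0. \<exists>H. H holomorphic_on ball (of_real x) p \<and>
      (\<forall>t. \<bar>t - x\<bar> < p \<longrightarrow> b (f t) (g t) = H (of_real t))"
    using F G by (intro exI[of _ "min r q"]) auto
qed

lemma real_analytic_add:
  "\<lbrakk>real_analytic f; real_analytic g\<rbrakk> \<Longrightarrow> real_analytic (\<lambda>t. f t + g t)"
  by (rule real_analytic_binop[of "(+)"]) (intro holomorphic_intros)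

lemma real_analytic_diff:
  "\<lbrakk>real_analytic f; real_analytic g\<rbrakk> \<Longrightarrow> real_analytic (\<lambda>t. f t - g t)"
  by (rule real_analytic_binop[of "(-)"]) (intro holomorphic_intros)

lemma real_analytic_mult:
  "\<lbrakk>real_analytic f; real_analytic g\<rbrakk> \<Longrightarrow> real_analytic (\<lambda>t. f t * g t)"
  by (rule real_analytic_binop[of "(*)"]) (intro holomorphic_intros)

lemma real_analytic_const: "real_analytic (\<lambda>t. c)"
  using real_analytic_entire[of "\<lambda>z. c"] by simp

lemma real_analytic_translate:
  assumes "real_analytic f"
  shows "real_analytic (\<lambda>t. f (t + a))"
  unfolding real_analytic_iff_locally_holomorphic locally_holomorphic_def
proof
  fix x
  obtain r F where r: "r > 0" and F: "F holomorphic_on ball (of_real (x + a)) r"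
    and eq: "\<forall>t. \<bar>t - (x + a)\<bar> < r \<longrightarrow> f t = F (of_real t)"
    using assms unfolding real_analytic_iff_locally_holomorphic locally_holomorphic_def by blast
  have "(F \<circ> (\<lambda>z. z + of_real a)) holomorphic_on ball (of_real x) r"
  proof (rule holomorphic_on_compose_gen[OF _ F])
    show "(\<lambda>z. z + complex_of_real a) ` ball (of_real x) r \<subseteq> ball (of_real (x + a)) r"
      by (auto simp: dist_norm algebra_simps)
  qed (intro holomorphic_intros)
  then show "\<exists>r>0. \<exists>F. F holomorphic_on ball (of_real x) r \<and>
      (\<forall>t. \<bar>t - x\<bar> < r \<longrightarrow> f (t + a) = F (of_real t))"
    using r eq by (intro exI[of _ r] conjI exI[of _ "F \<circ> (\<lambda>z. z + of_real a)"]) auto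
qed

text \<open>
  The set of points near which \<open>f\<close> vanishes is open by construction. It is closed by analytic
  continuation inside the disc of a local holomorphic extension, hence it is the whole line.
\<close>

lemma real_analytic_eq_0:
  assumes f: "real_analytic f" and "a < b" and zero: "\<And>t. \<lbrakk>a < t; t < b\<rbrakk> \<Longrightarrow> f t = 0"
  shows "f t = 0"
proof -
  define Z where "Z = {x. \<exists>e>0. \<forall>t. \<bar>t - x\<bar> < e \<longrightarrow> f t = 0}"
  have spread: "\<exists>r>0. \<forall>y\<in>Z. \<bar>y - x\<bar> < r \<longrightarrow> (\<forall>t. \<bar>t - x\<bar> < r \<longrightarrow> f t = 0)" for x
  proof -
    obtain r F where r: "r > 0" and F: "F holomorphic_on ball (of_real x) r"
      and eq: "\<forall>t. \<bar>t - x\<bar> < r \<longrightarrow> f t = F (of_real t)"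
      using f unfolding real_analytic_iff_locally_holomorphic locally_holomorphic_def by blast
    have "f t = 0" if y: "y \<in> Z" "\<bar>y - x\<bar> < r" and t: "\<bar>t - x\<bar> < r" for y t
    proof -
      obtain e where e: "e > 0" "\<And>t. \<bar>t - y\<bar> < e \<Longrightarrow> f t = 0"
        using y unfolding Z_def by blast
      define U where "U = complex_of_real ` {t. \<bar>t - y\<bar> < e \<and> \<bar>t - x\<bar> < r}"
      have "F (of_real t) = 0"
      proof (rule analytic_continuation[OF F])
        show "U \<subseteq> ball (of_real x) r"
          by (auto simp: U_def dist_commute dist_real_def)
        show "complex_of_real y islimpt U"
          unfolding islimpt_approachable
        proof (intro allI impI)
          fix \<epsilon> :: real assume "\<epsilon> > 0"
          have "0 < min (min \<epsilon> e) (r - \<bar>y - x\<bar>)"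
            using \<open>\<epsilon> > 0\<close> e(1) y(2) by simp
          then obtain h where "0 < h" "h < min (min \<epsilon> e) (r - \<bar>y - x\<bar>)"
            using dense by blast
          then have h: "0 < h" "h < \<epsilon>" "h < e" "h < r - \<bar>y - x\<bar>"
            by simp_all
          have "y + h \<in> {t. \<bar>t - y\<bar> < e \<and> \<bar>t - x\<bar> < r}"
            using h by auto
          then have "complex_of_real (y + h) \<in> U"
            unfolding U_def by blast
          moreover have "complex_of_real (y + h) \<noteq> of_real y" "dist (complex_of_real (y + h)) (of_real y) < \<epsilon>"
            using h by (auto simp: dist_norm)
          ultimately show "\<exists>z\<in>U. z \<noteq> of_real y \<and> dist z (of_real y) < \<epsilon>"
            by blast
        qed
        show "F z = 0" if "z \<in> U" for z
          using that e eq by (auto simp: U_def)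
      qed (use y t in \<open>auto simp: dist_commute dist_real_def\<close>)
      then show ?thesis
        using eq t by simp
    qed
    then show ?thesis
      using r by blast
  qed
  have "open Z"
    unfolding open_dist
  proof
    fix x assume "x \<in> Z"
    then obtain e where e: "e > 0" "\<And>t. \<bar>t - x\<bar> < e \<Longrightarrow> f t = 0"
      unfolding Z_def by blast
    have "y \<in> Z" if "dist y x < e" for y
      unfolding Z_def using that e by (intro CollectI exI[of _ "e - \<bar>y - x\<bar>"]) (auto simp: dist_real_def)
    then show "\<exists>e>0. \<forall>y. dist y x < e \<longrightarrow> y \<in> Z"
      using e by blast
  qed
  moreover have "closed Z"
    unfolding closed_limpt
  proof (intro allI impI)
    fix x assume x: "x islimpt Z"
    obtain r where r: "r > 0" "\<forall>y\<in>Z. \<bar>y - x\<bar> < r \<longrightarrow> (\<forall>t. \<bar>t - x\<bar> < r \<longrightarrow> f t = 0)"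
      using spread by blast
    obtain y where "y \<in> Z" "\<bar>y - x\<bar> < r"
      using x r unfolding islimpt_approachable dist_real_def by blast
    then have "\<forall>t. \<bar>t - x\<bar> < r \<longrightarrow> f t = 0"
      using r(2) by blast
    then show "x \<in> Z"
      unfolding Z_def using r(1) by (intro CollectI exI[of _ r]) simp
  qed
  moreover have "(a + b) / 2 \<in> Z"
    unfolding Z_def using \<open>a < b\<close> zero
    by (intro CollectI exI[of _ "(b - a) / 2"]) (auto simp: abs_less_iff field_simps)
  ultimately have "Z = UNIV"
    using clopen by blast
  then obtain e where "e > 0" "\<And>s. \<bar>s - t\<bar> < e \<Longrightarrow> f s = 0"
    unfolding Z_def by blast
  then show ?thesis
    by (metis abs_zero diff_self)
qed

lemma subspace_real_analytic: "cfun.subspace {f. real_analytic f}"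
proof (rule cfun.subspaceI)
  show "0 \<in> {f. real_analytic f}"
    using real_analytic_const[of 0] by (simp add: zero_fun_def)
next
  fix f g :: "real \<Rightarrow> complex" assume "f \<in> {f. real_analytic f}" "g \<in> {f. real_analytic f}"
  then show "f + g \<in> {f. real_analytic f}"
    using real_analytic_add[of f g] by (simp add: plus_fun_def)
next
  fix c and f :: "real \<Rightarrow> complex" assume "f \<in> {f. real_analytic f}"
  then show "scale_fun c f \<in> {f. real_analytic f}"
    using real_analytic_mult[OF real_analytic_const, of f c] by (simp add: scale_fun_def)
qed

lemma real_analytic_exp: "real_analytic (\<lambda>t. exp (\<mu> * of_real t))"
  by (rule real_analytic_entire) (intro holomorphic_intros)

lemma real_analytic_poly: "real_analytic (\<lambda>t. poly p (of_real t))"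
  by (rule real_analytic_entire) (intro holomorphic_intros)

section \<open>Polynomials in the unit shift\<close>

text \<open>
  The operator \<open>Q(S)\<close>, where \<open>S\<close> is the unit shift \<open>f \<mapsto> f(\<cdot> + 1)\<close>.
\<close>

definition shift_op :: "complex poly \<Rightarrow> (real \<Rightarrow> complex) \<Rightarrow> real \<Rightarrow> complex"
  where "shift_op Q f = (\<lambda>t. \<Sum>i\<le>degree Q. coeff Q i * f (t + of_nat i))"

lemma shift_op_eq_sum:
  assumes "degree Q \<le> n"
  shows "shift_op Q f t = (\<Sum>i\<le>n. coeff Q i * f (t + of_nat i))"
  unfolding shift_op_def using assms by (intro sum.mono_neutral_left) (auto simp: coeff_eq_0)

lemma shift_op_0 [simp]: "shift_op 0 f = (\<lambda>t. 0)"
  by (simp add: shift_op_def)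

lemma shift_op_add: "shift_op (P + Q) f t = shift_op P f t + shift_op Q f t"
proof -
  define n where "n = max (degree P) (degree Q)"
  have "degree P \<le> n" "degree Q \<le> n" "degree (P + Q) \<le> n"
    by (auto simp: n_def intro: degree_add_le)
  then show ?thesis
    by (simp add: shift_op_eq_sum ring_distribs sum.distrib)
qed

lemma shift_op_smult: "shift_op (smult c Q) f t = c * shift_op Q f t"
  using shift_op_eq_sum[OF degree_smult_le, of c Q f t] by (simp add: shift_op_def sum_distrib_left mult.assoc)

lemma shift_op_pCons: "shift_op (pCons a Q) f t = a * f t + shift_op Q f (t + 1)"
proof -
  have "shift_op (pCons a Q) f t = (\<Sum>i\<le>Suc (degree Q). coeff (pCons a Q) i * f (t + of_nat i))"
    by (rule shift_op_eq_sum) (simp add: degree_pCons_le)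
  also have "\<dots> = a * f t + shift_op Q f (t + 1)"
    by (simp add: sum.atMost_Suc_shift shift_op_def add_ac del: sum.atMost_Suc)
  finally show ?thesis .
qed

lemma shift_op_mult: "shift_op (P * Q) f t = shift_op P (shift_op Q f) t"
proof (induction P arbitrary: t)
  case (pCons a P)
  then show ?case
    by (simp add: mult_pCons_left shift_op_add shift_op_smult shift_op_pCons)
qed simp

lemma shift_op_1 [simp]: "shift_op 1 f = f"
  by (simp add: shift_op_def)

lemma shift_op_linear: "shift_op [:-z, 1:] f t = f (t + 1) - z * f t"
  by (simp add: shift_op_pCons)

lemma shift_op_diff_right: "shift_op Q (\<lambda>t. f t - g t) t = shift_op Q f t - shift_op Q g t"
  by (simp add: shift_op_def ring_distribs sum_subtractf)

lemma shift_op_zero_right [simp]: "shift_op Q (\<lambda>t. 0) = (\<lambda>t. 0)"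
  by (simp add: shift_op_def)

lemma shift_op_in_subspace:
  assumes U: "cfun.subspace U" and shift: "\<And>g. g \<in> U \<Longrightarrow> (\<lambda>t. g (t + 1)) \<in> U" and f: "f \<in> U"
  shows "shift_op Q f \<in> U"
proof (induction Q)
  case 0
  then show ?case
    using cfun.subspace_0[OF U] by (simp add: zero_fun_def)
next
  case (pCons a Q)
  have "shift_op (pCons a Q) f = scale_fun a f + (\<lambda>t. shift_op Q f (t + 1))"
    by (simp add: fun_eq_iff shift_op_pCons scale_fun_def)
  then show ?case
    using pCons.IH f by (simp only: cfun.subspace_add[OF U] cfun.subspace_scale[OF U] shift)
qed

lemma real_analytic_shift_op: "real_analytic f \<Longrightarrow> real_analytic (shift_op Q f)"
  using shift_op_in_subspace[OF subspace_real_analytic, of f Q] by (simp add: real_analytic_translate)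

lemma shift_op_sum: "shift_op (\<Sum>k\<in>K. P k) f t = (\<Sum>k\<in>K. shift_op (P k) f t)"
  by (induction K rule: infinite_finite_induct) (simp_all add: shift_op_add)

lemma shift_op_sum_right: "shift_op Q (\<lambda>t. \<Sum>b\<in>B. c b * g b t) t = (\<Sum>b\<in>B. c b * shift_op Q (g b) t)"
  by (simp add: shift_op_def sum_distrib_left mult_ac sum.swap[of _ B])

lemma shift_op_scale_right: "shift_op Q (\<lambda>t. c * g t) t = c * shift_op Q g t"
  by (simp add: shift_op_def sum_distrib_left mult_ac)

lemma shift_op_monom: "shift_op (monom c i) f t = c * f (t + of_nat i)"
proof (induction i arbitrary: t)
  case 0
  then show ?case by (simp add: monom_0 shift_op_pCons)
next
  case (Suc i)
  then show ?case by (simp add: monom_Suc shift_op_pCons add_ac)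
qed

lemma shift_invariantD_add1:
  assumes "shift_invariant U" "g \<in> U"
  shows "(\<lambda>t. g (t + 1)) \<in> U"
proof -
  have "(\<lambda>t. g (t - of_int (-1))) \<in> U"
    using assms unfolding shift_invariant_def by blast
  then show ?thesis by simp
qed

lemma shift_invariantD_nat:
  assumes "shift_invariant U" "g \<in> U"
  shows "(\<lambda>t. g (t - of_nat n)) \<in> U"
proof -
  have "(\<lambda>t. g (t - of_int (int n))) \<in> U"
    using assms unfolding shift_invariant_def by blast
  then show ?thesis by simp
qed

text \<open>
  Induction on the set of roots: the factor belonging to one root is coprime to the product of the
  others, and a Bezout identity between the two writes \<open>f\<close> as a sum of two elements of \<open>U\<close>, each
  killed by one of the two factors.
\<close>

lemma primary_decomposition:
  assumes U: "cfun.subspace U" and shift: "\<And>g. g \<in> U \<Longrightarrow> (\<lambda>t. g (t + 1)) \<in> U" 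
    and "finite Z" "f \<in> U" "shift_op (\<Prod>z\<in>Z. [:-z, 1:] ^ m z) f = (\<lambda>t. 0)"
  shows "f \<in> cfun.span (\<Union>z\<in>Z. {g \<in> U. shift_op ([:-z, 1:] ^ m z) g = (\<lambda>t. 0)})"
  using assms(3-)
proof (induction Z arbitrary: f rule: finite_induct)
  case empty
  then show ?case
    by (simp add: zero_fun_def)
next
  case (insert z Z)
  define P where "P = [:-z, 1:] ^ m z"
  define Q where "Q = (\<Prod>z\<in>Z. [:-z, 1:] ^ m z)"
  have PQ: "shift_op (P * Q) f = (\<lambda>t. 0)"
    using insert.prems insert.hyps by (simp add: P_def Q_def)
  have "coprime P Q"
    unfolding P_def Q_def
  proof (rule prod_coprime_right)
    fix w assume "w \<in> Z"
    then have "w \<noteq> z"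
      using insert.hyps by blast
    have "coprime [:-z, 1:] [:-w, 1:]"
    proof (rule coprimeI)
      fix r assume "r dvd [:-z, 1:]" "r dvd [:-w, 1:]"
      then have "r dvd [:-z, 1:] - [:-w, 1:]"
        by (rule dvd_diff)
      then have "r dvd [:w - z:]"
        by simp
      moreover have "is_unit [:w - z:]"
        using \<open>w \<noteq> z\<close> by (simp add: is_unit_const_poly_iff dvd_field_iff)
      ultimately show "is_unit r"
        by (rule dvd_trans)
    qed
    then show "coprime ([:-z, 1:] ^ m z) ([:-w, 1:] ^ m w)"
      by simp
  qed
  then obtain u v where uv: "u * P + v * Q = 1"
    using bezout_coefficients_fst_snd[of P Q] coprime_iff_gcd_eq_1 by metis
  let ?g = "shift_op (v * Q) f" and ?h = "shift_op (u * P) f"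
  have "f t = ?h t + ?g t" for t
    using shift_op_add[of "u * P" "v * Q" f t] by (simp add: uv)
  then have split: "f = ?h + ?g"
    by (simp add: fun_eq_iff)
  have kill: "shift_op R (shift_op S f) = (\<lambda>t. 0)" if "R * S = w * (P * Q)" for R S w
  proof
    fix t
    have "shift_op R (shift_op S f) t = shift_op w (shift_op (P * Q) f) t"
      by (simp only: that flip: shift_op_mult)
    then show "shift_op R (shift_op S f) t = 0"
      by (simp only: PQ shift_op_zero_right)
  qed
  have "?g \<in> U" "?h \<in> U"
    using shift_op_in_subspace[OF U shift \<open>f \<in> U\<close>] by auto
  moreover have "shift_op P ?g = (\<lambda>t. 0)" "shift_op Q ?h = (\<lambda>t. 0)"
    by (rule kill[of _ _ v] kill[of _ _ u], simp add: algebra_simps)+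
  ultimately have "?g \<in> (\<Union>z\<in>insert z Z. {g \<in> U. shift_op ([:-z, 1:] ^ m z) g = (\<lambda>t. 0)})"
    and "?h \<in> cfun.span (\<Union>z\<in>Z. {g \<in> U. shift_op ([:-z, 1:] ^ m z) g = (\<lambda>t. 0)})"
    using insert.IH by (auto simp: P_def Q_def)
  then have "?g \<in> cfun.span (\<Union>z\<in>insert z Z. {g \<in> U. shift_op ([:-z, 1:] ^ m z) g = (\<lambda>t. 0)})"
    and "?h \<in> cfun.span (\<Union>z\<in>insert z Z. {g \<in> U. shift_op ([:-z, 1:] ^ m z) g = (\<lambda>t. 0)})"
    using cfun.span_mono[of "\<Union>z\<in>Z. {g \<in> U. shift_op ([:-z, 1:] ^ m z) g = (\<lambda>t. 0)}"
      "\<Union>z\<in>insert z Z. {g \<in> U. shift_op ([:-z, 1:] ^ m z) g = (\<lambda>t. 0)}"]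
    by (auto intro: cfun.span_base)
  then show ?case
    by (subst split) (intro cfun.span_add)
qed

section \<open>Finite determination by nodes\<close>

text \<open>
  A family of vectors with finitely many coordinates is spanned by a finite subfamily; this is the
  only dimension argument of the development. It is applied to the values of the generators (giving
  interpolation nodes), to functions restricted to the nodes (giving finite spanning sets), and to
  iterated shifts (giving an annihilating polynomial). The proof adds one coordinate at a time: if
  the combinations that match all earlier coordinates miss the new one for some index \<open>s\<close>, then
  adjoining \<open>s\<close> corrects the error for all indices.
\<close>

lemma finite_subfamily_spans:
  fixes v :: "'a \<Rightarrow> 'i \<Rightarrow> complex"
  assumes "finite I"
  shows "\<exists>X\<subseteq>T. finite X \<and> (\<forall>t\<in>T. \<exists>a. \<forall>i\<in>I. v t i = (\<Sum>x\<in>X. a x * v x i))"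
  using assms
proof (induction I rule: finite_induct)
  case empty
  show ?case by (intro exI[of _ "{}"]) auto
next
  case (insert j I)
  then obtain X where X: "X \<subseteq> T" "finite X"
    and "\<forall>t\<in>T. \<exists>a. \<forall>i\<in>I. v t i = (\<Sum>x\<in>X. a x * v x i)"
    by blast
  then obtain a where a: "\<And>t i. \<lbrakk>t \<in> T; i \<in> I\<rbrakk> \<Longrightarrow> v t i = (\<Sum>x\<in>X. a t x * v x i)"
    by metis
  define w where "w t = v t j - (\<Sum>x\<in>X. a t x * v x j)" for t
  show ?case
  proof (cases "\<exists>s\<in>T. w s \<noteq> 0")
    case False
    then have "v t i = (\<Sum>x\<in>X. a t x * v x i)" if "t \<in> T" "i \<in> insert j I" for t i
      using a that by (auto simp: w_def)
    then show ?thesis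
      using X by (intro exI[of _ X]) blast
  next
    case True
    then obtain s where s: "s \<in> T" "w s \<noteq> 0"
      by blast
    have "\<exists>b. \<forall>i\<in>insert j I. v t i = (\<Sum>x\<in>insert s X. b x * v x i)" if t: "t \<in> T" for t
    proof -
      \<comment> \<open>\<open>q\<close> times the residual vector of \<open>s\<close> corrects coordinate \<open>j\<close> and leaves those in \<open>I\<close> unchanged.\<close>
      define q where "q = w t / w s"
      define b where "b x = (if x \<in> X then a t x - q * a s x else 0) + (if x = s then q else 0)" for x
      have ext: "(\<Sum>x\<in>insert s X. (if x \<in> X then g x else 0)) = sum g X" for g :: "'a \<Rightarrow> complex"
        using X(2) by (simp add: sum.inter_restrict[symmetric] Int_absorb1 subset_insertI)
      have single: "(\<Sum>x\<in>insert s X. (if x = s then q else 0) * v x i) = q * v s i" for i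
        using X(2) by (simp add: if_distrib[of "\<lambda>c. c * _"] sum.delta cong: if_cong)
      have b: "(\<Sum>x\<in>insert s X. b x * v x i)
          = (\<Sum>x\<in>X. a t x * v x i) + q * (v s i - (\<Sum>x\<in>X. a s x * v x i))" for i
      proof -
        have "(\<Sum>x\<in>insert s X. b x * v x i)
            = (\<Sum>x\<in>insert s X. (if x \<in> X then (a t x - q * a s x) * v x i else 0)) + q * v s i"
          unfolding single[symmetric] sum.distrib[symmetric]
          by (intro sum.cong) (auto simp: b_def ring_distribs)
        also have "\<dots> = (\<Sum>x\<in>X. (a t x - q * a s x) * v x i) + q * v s i"
          by (simp only: ext)
        finally show ?thesis
          by (simp add: algebra_simps sum_subtractf sum_distrib_left)
      qed
      have "v t i = (\<Sum>x\<in>insert s X. b x * v x i)" if "i \<in> insert j I" for i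
        unfolding b using that a[OF t] a[OF s(1)] s(2) by (auto simp: q_def w_def field_simps)
      then show ?thesis
        by blast
    qed
    then show ?thesis
      using X s by (intro exI[of _ "insert s X"]) auto
  qed
qed

definition vanishing_on :: "'a set \<Rightarrow> ('a \<Rightarrow> complex) set"
  where "vanishing_on X = {f. \<forall>x\<in>X. f x = 0}"

lemma subspace_sum_scale:
  assumes "cfun.subspace U" "\<And>b. b \<in> B \<Longrightarrow> g b \<in> U"
  shows "(\<lambda>t. \<Sum>b\<in>B. c b * g b t) \<in> U"
proof -
  have "(\<Sum>b\<in>B. scale_fun (c b) (g b)) \<in> U"
    using assms by (intro cfun.subspace_sum cfun.subspace_scale) auto
  moreover have "(\<Sum>b\<in>B. scale_fun (c b) (g b)) = (\<lambda>t. \<Sum>b\<in>B. c b * g b t)"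
    by (induction B rule: infinite_finite_induct) (auto simp: scale_fun_def fun_eq_iff)
  ultimately show ?thesis by simp
qed

text \<open>
  The values at the nodes are coordinates on \<open>H\<close>, so an identity between values at the nodes is an
  identity of functions.
\<close>

lemma finite_spanning_subset:
  assumes H: "cfun.subspace H" and "finite X" and nodes: "H \<inter> vanishing_on X \<subseteq> {\<lambda>t. 0}"
    and "G \<subseteq> H"
  obtains B where "finite B" "B \<subseteq> G" "\<forall>f\<in>G. \<exists>a. f = (\<lambda>t. \<Sum>b\<in>B. a b * b t)"
proof -
  obtain B where B: "B \<subseteq> G" "finite B"
    and rep: "\<forall>f\<in>G. \<exists>a. \<forall>x\<in>X. f x = (\<Sum>b\<in>B. a b * b x)"
    using finite_subfamily_spans[OF \<open>finite X\<close>, of G "\<lambda>f. f"] by auto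
  show ?thesis
  proof (rule that[OF B(2,1)], rule ballI)
    fix f assume f: "f \<in> G"
    then obtain a where a: "\<And>x. x \<in> X \<Longrightarrow> f x = (\<Sum>b\<in>B. a b * b x)"
      using rep by blast
    have "(\<lambda>t. \<Sum>b\<in>B. a b * b t) \<in> H"
      using subspace_sum_scale[OF H, of B "\<lambda>b. b" a] B \<open>G \<subseteq> H\<close> by blast
    then have "f - (\<lambda>t. \<Sum>b\<in>B. a b * b t) \<in> H"
      using f \<open>G \<subseteq> H\<close> by (intro cfun.subspace_diff[OF H]) auto
    moreover have "f - (\<lambda>t. \<Sum>b\<in>B. a b * b t) \<in> vanishing_on X"
      by (simp add: vanishing_on_def a)
    ultimately have "f - (\<lambda>t. \<Sum>b\<in>B. a b * b t) = (\<lambda>t. 0)"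
      using nodes by auto
    then show "\<exists>a. f = (\<lambda>t. \<Sum>b\<in>B. a b * b t)"
      by (auto simp: fun_eq_iff)
  qed
qed

text \<open>
  On \<open>T\<close>, every element of \<open>V\<close> is recovered from its values at the nodes by formulas
  \<open>f t = (\<Sum>x\<in>X. a t x * f x)\<close> whose coefficients do not depend on \<open>f\<close>. Each of these is a closed
  condition for pointwise convergence, so it holds on the closure of \<open>V\<close> as well.
\<close>

lemma finite_interpolation_nodes:
  fixes \<psi> :: "'i \<Rightarrow> 'a \<Rightarrow> complex"
  assumes "finite I" and V: "\<And>f. f \<in> V \<Longrightarrow> \<exists>c. \<forall>t\<in>T. f t = (\<Sum>i\<in>I. c i * \<psi> i t)"
  obtains X where "finite X" "X \<subseteq> T" "closure V \<inter> vanishing_on X \<subseteq> vanishing_on T"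
proof -
  obtain X where X: "X \<subseteq> T" "finite X"
    and "\<forall>t\<in>T. \<exists>a. \<forall>i\<in>I. \<psi> i t = (\<Sum>x\<in>X. a x * \<psi> i x)"
    using finite_subfamily_spans[OF \<open>finite I\<close>, of T "\<lambda>t i. \<psi> i t"] by auto
  then obtain a where a: "\<And>t i. \<lbrakk>t \<in> T; i \<in> I\<rbrakk> \<Longrightarrow> \<psi> i t = (\<Sum>x\<in>X. a t x * \<psi> i x)"
    by metis
  have rep: "f t = (\<Sum>x\<in>X. a t x * f x)" if f: "f \<in> V" and t: "t \<in> T" for f t
  proof -
    obtain c where c: "\<And>t. t \<in> T \<Longrightarrow> f t = (\<Sum>i\<in>I. c i * \<psi> i t)"
      using V[OF f] by blast
    have "f t = (\<Sum>i\<in>I. c i * (\<Sum>x\<in>X. a t x * \<psi> i x))"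
      using c[OF t] a[OF t] by simp
    also have "\<dots> = (\<Sum>x\<in>X. a t x * (\<Sum>i\<in>I. c i * \<psi> i x))"
      by (simp add: sum_distrib_left mult_ac sum.swap[of _ X I])
    also have "\<dots> = (\<Sum>x\<in>X. a t x * f x)"
      using c X(1) by (intro sum.cong) auto
    finally show ?thesis .
  qed
  have closed_rep: "f t = (\<Sum>x\<in>X. a t x * f x)" if f: "f \<in> closure V" and t: "t \<in> T" for f t
  proof -
    have coord: "continuous_on UNIV (\<lambda>f :: 'a \<Rightarrow> complex. f x)" for x
      by (rule continuous_on_product_coordinates)
    have "closed {f :: 'a \<Rightarrow> complex. f t = (\<Sum>x\<in>X. a t x * f x)}"
      by (intro closed_Collect_eq continuous_intros coord)
    then have "closure V \<subseteq> {f. f t = (\<Sum>x\<in>X. a t x * f x)}"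
      using rep t by (intro closure_minimal) auto
    then show ?thesis
      using f by blast
  qed
  show ?thesis
  proof (rule that[OF X(2,1)], rule subsetI)
    fix f assume f: "f \<in> closure V \<inter> vanishing_on X"
    then show "f \<in> vanishing_on T"
      using closed_rep[of f] by (simp add: vanishing_on_def)
  qed
qed

text \<open>
  All backward shifts of a finite spanning set are combinations of finitely many of them. For \<open>n\<close>
  beyond those finitely many exponents, this expresses \<open>S\<^sup>-\<^sup>n\<close> as a combination of \<open>S\<^sup>-\<^sup>k\<close> with
  \<open>k < n\<close>. Multiplication by \<open>S\<^sup>n\<close> gives a polynomial relation with constant term 1. Backward shifts
  are used precisely to obtain a nonzero constant term, so that all roots have logarithms.
\<close>

lemma annihilating_polynomial:
  assumes H: "cfun.subspace H" and shift: "shift_invariant H" and "finite X"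
    and nodes: "H \<inter> vanishing_on X \<subseteq> {\<lambda>t. 0}"
  obtains Q where "poly Q 0 \<noteq> 0" "\<forall>f\<in>H. shift_op Q f = (\<lambda>t. 0)"
proof -
  obtain B where B: "finite B" "B \<subseteq> H" and span: "\<forall>f\<in>H. \<exists>a. f = (\<lambda>t. \<Sum>b\<in>B. a b * b t)"
    by (rule finite_spanning_subset[OF H \<open>finite X\<close> nodes order_refl])
  have "\<exists>K\<subseteq>UNIV. finite K \<and> (\<forall>n\<in>UNIV. \<exists>a. \<forall>i\<in>B \<times> X.
      fst i (snd i - of_nat n) = (\<Sum>k\<in>K. a k * fst i (snd i - of_nat k)))"
    by (rule finite_subfamily_spans) (use B \<open>finite X\<close> in simp)
  then obtain K :: "nat set" where K: "finite K" and rep: "\<And>n. \<exists>a. \<forall>i\<in>B \<times> X.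
      fst i (snd i - of_nat n) = (\<Sum>k\<in>K. a k * fst i (snd i - of_nat k))"
    by auto
  obtain n where "K \<subseteq> {..<n}"
    using finite_nat_bounded[OF K] by blast
  then have n: "k < n" if "k \<in> K" for k
    using that by blast
  obtain a where rep_n: "\<forall>i\<in>B \<times> X. fst i (snd i - of_nat n) = (\<Sum>k\<in>K. a k * fst i (snd i - of_nat k))"
    using rep[of n] by (rule exE)
  have a: "b (x - of_nat n) = (\<Sum>k\<in>K. a k * b (x - of_nat k))" if "b \<in> B" "x \<in> X" for b x
    using bspec[OF rep_n SigmaI[OF that]] by simp
  define Q where "Q = 1 - (\<Sum>k\<in>K. monom (a k) (n - k))"
  have "(\<Sum>k\<in>K. poly (monom (a k) (n - k)) 0) = 0"
    by (intro sum.neutral ballI) (simp add: poly_monom n)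
  then have "poly Q 0 = 1"
    by (simp add: Q_def poly_sum)
  moreover have shift_op_b: "shift_op Q b = (\<lambda>t. 0)" if b: "b \<in> B" for b
  proof
    fix t
    have "(\<lambda>t. b (t - of_nat n)) - (\<lambda>t. \<Sum>k\<in>K. a k * b (t - of_nat k)) \<in> H"
      using b B(2) shift by (intro cfun.subspace_diff[OF H] subspace_sum_scale[OF H] shift_invariantD_nat) auto
    moreover have "(\<lambda>t. b (t - of_nat n)) - (\<lambda>t. \<Sum>k\<in>K. a k * b (t - of_nat k)) \<in> vanishing_on X"
      by (simp add: vanishing_on_def a b)
    ultimately have "(\<lambda>t. b (t - of_nat n)) - (\<lambda>t. \<Sum>k\<in>K. a k * b (t - of_nat k)) = (\<lambda>t. 0)"
      using nodes by blast
    from fun_cong[OF this, of "t + of_nat n"]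
    have "b (t + of_nat n - of_nat n) = (\<Sum>k\<in>K. a k * b (t + of_nat n - of_nat k))"
      by simp
    also have "\<dots> = (\<Sum>k\<in>K. a k * b (t + of_nat (n - k)))"
      using n by (intro sum.cong) (simp_all add: less_imp_le of_nat_diff add_diff_eq)
    finally have "b t = (\<Sum>k\<in>K. a k * b (t + of_nat (n - k)))"
      by simp
    moreover have "shift_op Q b t + shift_op (\<Sum>k\<in>K. monom (a k) (n - k)) b t = b t"
      unfolding shift_op_add[symmetric] by (simp add: Q_def)
    ultimately show "shift_op Q b t = 0"
      by (simp add: shift_op_sum shift_op_monom)
  qed
  moreover have "shift_op Q f = (\<lambda>t. 0)" if f: "f \<in> H" for f
  proof -
    obtain c where "f = (\<lambda>t. \<Sum>b\<in>B. c b * b t)"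
      using span f by blast
    then have "shift_op Q f t = (\<Sum>b\<in>B. c b * shift_op Q b t)" for t
      using shift_op_sum_right by simp
    then show ?thesis
      by (simp add: shift_op_b fun_eq_iff)
  qed
  ultimately show ?thesis
    by (intro that[of Q]) auto
qed

section \<open>Generalized eigenfunctions of the shift\<close>

definition binomial_poly :: "nat \<Rightarrow> complex poly"
  where "binomial_poly k = smult (1 / fact k) (\<Prod>j = 0..<k. [:- of_nat j, 1:])"

lemma poly_binomial_poly: "poly (binomial_poly k) x = x gchoose k"
  by (simp add: binomial_poly_def gbinomial_prod_rev poly_prod divide_simps)

lemma degree_binomial_poly: "degree (binomial_poly k) \<le> k"
proof -
  have "degree (\<Prod>j = 0..<k. [:- of_nat j, 1 :: complex:]) \<le> (\<Sum>j = 0..<k. 1)"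
    by (rule order.trans[OF degree_prod_sum_le]) (auto intro!: sum_mono)
  then show ?thesis
    by (simp add: binomial_poly_def)
qed

text \<open>
  For \<open>z = 1\<close> this is the fact that the \<open>k\<close>-th difference of \<open>t gchoose k\<close> is 1, while 1-periodic
  factors behave as constants. The exponential factor turns \<open>S - 1\<close> into \<open>S - z\<close>.
\<close>

lemma shift_op_power_binomial:
  assumes z: "exp \<mu> = z" and per: "\<And>t. \<pi> (t + 1) = \<pi> t"
  shows "shift_op ([:-z, 1:] ^ k) (\<lambda>t. exp (\<mu> * of_real t) * ((of_real t gchoose k) * \<pi> t)) t
    = z ^ k * (exp (\<mu> * of_real t) * \<pi> t)"
proof (induction k arbitrary: t)
  case (Suc k)
  have step: "shift_op [:-z, 1:] (\<lambda>t. exp (\<mu> * of_real t) * ((of_real t gchoose Suc k) * \<pi> t))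
      = (\<lambda>t. z * (exp (\<mu> * of_real t) * ((of_real t gchoose k) * \<pi> t)))"
    by (simp add: fun_eq_iff shift_op_linear per gbinomial_Suc_Suc ring_distribs exp_add z mult_ac)
  have "[:-z, 1:] ^ Suc k = [:-z, 1:] ^ k * [:-z, 1:]"
    by (simp only: power_Suc mult.commute)
  then show ?case
    by (simp only: shift_op_mult step shift_op_scale_right Suc.IH) (simp add: mult_ac)
qed simp

text \<open>
  Induction on \<open>m\<close>. If \<open>(S - z)^(m + 1) f = 0\<close>, then \<open>(S - z)^m f\<close> is 0 or an eigenfunction, hence \<open>exp (\<mu> t)\<close> times a
  periodic function \<open>\<rho>\<close>, up to the scalar \<open>z ^ m\<close>. Subtracting the term with \<open>t gchoose m\<close> and
  coefficient \<open>\<rho>\<close> leaves a function killed by \<open>(S - z)^m\<close>.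
\<close>

lemma generalized_eigenfunction_expansion:
  assumes z: "exp \<mu> = z" and "real_analytic f" "shift_op ([:-z, 1:] ^ m) f = (\<lambda>t. 0)"
  shows "\<exists>\<pi>. (\<forall>i. periodic_fun_simple' (\<pi> i) \<and> real_analytic (\<pi> i)) \<and>
    f = (\<lambda>t. exp (\<mu> * of_real t) * (\<Sum>i<m. (of_real t gchoose i) * \<pi> i t))"
  using assms(2,3)
proof (induction m arbitrary: f)
  case 0
  then show ?case
    by (intro exI[of _ "\<lambda>i t. 0"]) (simp add: real_analytic_const periodic_fun_simple'_def)
next
  case (Suc m)
  have "z \<noteq> 0"
    using z by auto
  define h where "h = shift_op ([:-z, 1:] ^ m) f"
  \<comment> \<open>The scalar compensates the factor \<open>z ^ m\<close> that \<open>(S - z)^m\<close> produces from \<open>t gchoose m\<close>.\<close>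
  define \<rho> where "\<rho> = (\<lambda>t. inverse (z ^ m) * exp (-\<mu> * of_real t) * h t)"
  have "shift_op [:-z, 1:] h = (\<lambda>t. 0)"
  proof
    fix t
    have "shift_op [:-z, 1:] h t = shift_op ([:-z, 1:] ^ Suc m) f t"
      by (simp only: h_def power_Suc shift_op_mult)
    then show "shift_op [:-z, 1:] h t = 0"
      by (simp only: Suc.prems(2))
  qed
  then have h: "h (t + 1) = z * h t" for t
    by (simp add: shift_op_linear fun_eq_iff)
  have per: "\<rho> (t + 1) = \<rho> t" for t
    using \<open>z \<noteq> 0\<close> by (simp add: \<rho>_def h ring_distribs exp_diff z)
  have \<rho>: "real_analytic \<rho>"
    unfolding \<rho>_def h_def
    by (intro real_analytic_mult real_analytic_const real_analytic_exp real_analytic_shift_op Suc.prems)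
  have \<rho>_h: "z ^ m * (exp (\<mu> * of_real t) * \<rho> t) = h t" for t
    using \<open>z \<noteq> 0\<close> by (simp add: \<rho>_def exp_minus field_simps)
  define g where "g = (\<lambda>t. exp (\<mu> * of_real t) * ((of_real t gchoose m) * \<rho> t))"
  have "real_analytic (\<lambda>t. f t - g t)"
    unfolding g_def poly_binomial_poly[symmetric]
    by (intro real_analytic_diff real_analytic_mult real_analytic_exp real_analytic_poly \<rho> Suc.prems)
  moreover have "shift_op ([:-z, 1:] ^ m) (\<lambda>t. f t - g t) = (\<lambda>t. 0)"
    by (simp add: fun_eq_iff shift_op_diff_right g_def shift_op_power_binomial[of \<mu> z \<rho>, OF z per] \<rho>_h)
      (simp add: h_def)
  ultimately obtain \<pi> where \<pi>: "\<forall>i. periodic_fun_simple' (\<pi> i) \<and> real_analytic (\<pi> i)"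
    "(\<lambda>t. f t - g t) = (\<lambda>t. exp (\<mu> * of_real t) * (\<Sum>i<m. (of_real t gchoose i) * \<pi> i t))"
    using Suc.IH by blast
  have "f t = exp (\<mu> * of_real t) * (\<Sum>i<Suc m. (of_real t gchoose i) * (\<pi>(m := \<rho>)) i t)" for t
    using fun_cong[OF \<pi>(2), of t] by (simp add: g_def ring_distribs algebra_simps)
  moreover have "periodic_fun_simple' \<rho>"
    using per by (simp add: periodic_fun_simple'_def)
  ultimately show ?case
    using \<pi>(1) \<rho> by (intro exI[of _ "\<pi>(m := \<rho>)"]) auto
qed

section \<open>Exponential polynomials given by tuples\<close>

text \<open>
  Position \<open>k\<close> of a tuple admits degrees up to \<open>k\<close> only. The coefficient functions are therefore
  placed at the positions \<open>m, m + 1, \<dots>\<close>, and the positions below \<open>m\<close> carry the zero function.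
\<close>

lemma pack_into_tuple:
  fixes \<pi> :: "'i \<Rightarrow> real \<Rightarrow> complex"
  assumes "finite I"
  obtains d \<pi>' where "\<forall>k. \<pi>' k \<in> insert (\<lambda>t. 0) (\<pi> ` I)"
    and "\<forall>p. (\<forall>i\<in>I. degree (p i) \<le> m) \<longrightarrow>
      (\<exists>q\<in>poly_tuples d. \<forall>t. (\<Sum>k=0..d. poly (q k) (of_real t) * \<pi>' k t)
        = (\<Sum>i\<in>I. poly (p i) (of_real t) * \<pi> i t))"
proof -
  obtain b where b: "bij_betw b {0..<card I} I"
    using ex_bij_betw_nat_finite[OF assms] by blast
  define d where "d = m + card I"
  define J where "J = {m..<d}"
  define \<pi>' where "\<pi>' k = (if k \<in> J then \<pi> (b (k - m)) else (\<lambda>t. 0))" for k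
  have range_b: "b (k - m) \<in> I" if "k \<in> J" for k
    using that bij_betwE[OF b] by (auto simp: J_def d_def)
  have "bij_betw (\<lambda>k. k - m) J {0..<card I}"
    by (rule bij_betwI[of _ _ _ "\<lambda>k. k + m"]) (auto simp: J_def d_def)
  then have bJ: "bij_betw (\<lambda>k. b (k - m)) J I"
    using bij_betw_trans[OF _ b] by (simp add: comp_def)
  have pack: "\<exists>q\<in>poly_tuples d. \<forall>t. (\<Sum>k=0..d. poly (q k) (of_real t) * \<pi>' k t)
        = (\<Sum>i\<in>I. poly (p i) (of_real t) * \<pi> i t)"
    if p: "\<forall>i\<in>I. degree (p i) \<le> m" for p
  proof -
    define q where "q k = (if k \<in> J then p (b (k - m)) else 0)" for k
    have "degree (q k) \<le> k" for k
    proof (cases "k \<in> J")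
      case True
      then have "degree (q k) \<le> m" "m \<le> k"
        using p range_b by (auto simp: q_def J_def)
      then show ?thesis by (rule order.trans)
    qed (simp add: q_def)
    then have "q \<in> poly_tuples d"
      by (simp add: poly_tuples_def q_def J_def)
    moreover have "(\<Sum>k=0..d. poly (q k) (of_real t) * \<pi>' k t)
        = (\<Sum>i\<in>I. poly (p i) (of_real t) * \<pi> i t)" for t
    proof -
      have "(\<Sum>k=0..d. poly (q k) (of_real t) * \<pi>' k t)
          = (\<Sum>k\<in>J. poly (p (b (k - m))) (of_real t) * \<pi> (b (k - m)) t)"
        by (rule sum.mono_neutral_cong_right) (auto simp: q_def \<pi>'_def J_def)
      also have "\<dots> = (\<Sum>i\<in>I. poly (p i) (of_real t) * \<pi> i t)"
        by (rule sum.reindex_bij_betw[OF bJ])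
      finally show ?thesis .
    qed
    ultimately show ?thesis
      by (intro bexI[of _ q] allI)
  qed
  show ?thesis
  proof (rule that[of \<pi>' d])
    show "\<forall>k. \<pi>' k \<in> insert (\<lambda>t. 0) (\<pi> ` I)"
      using range_b by (simp add: \<pi>'_def)
  qed (intro allI impI pack)
qed

definition exp_poly :: "complex \<Rightarrow> nat \<Rightarrow> (nat \<Rightarrow> real \<Rightarrow> complex) \<Rightarrow> (nat \<Rightarrow> complex poly) \<Rightarrow> real \<Rightarrow> complex"
  where "exp_poly \<mu> d \<pi> p =
    (\<lambda>t. exp (\<mu> * of_real t) * (\<Sum>k=0..d. poly (p k) (of_real t) * \<pi> k t))"

lemma exp_poly_space_eq_image: "exp_poly_space \<mu> d \<pi> N = exp_poly \<mu> d \<pi> ` N"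
  by (auto simp: exp_poly_space_def exp_poly_def)

text \<open>
  A finite spanning set of the generalized eigenspace involves finitely many periodic coefficients; the
  same coefficients serve for all linear combinations.
\<close>

lemma generalized_eigenspace_exp_poly:
  assumes H: "cfun.subspace H" and "finite X"
    and nodes: "H \<inter> vanishing_on X \<subseteq> {\<lambda>t. 0}"
    and analytic: "\<And>f. f \<in> H \<Longrightarrow> real_analytic f"
    and z: "exp \<mu> = z"
  shows "\<exists>d \<pi>. (\<forall>k. periodic_fun_simple' (\<pi> k) \<and> real_analytic (\<pi> k)) \<and>
    {f \<in> H. shift_op ([:-z, 1:] ^ m) f = (\<lambda>t. 0)} \<subseteq> exp_poly \<mu> d \<pi> ` poly_tuples d"
proof -
  define G where "G = {f \<in> H. shift_op ([:-z, 1:] ^ m) f = (\<lambda>t. 0)}"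
  have "G \<subseteq> H"
    by (auto simp: G_def)
  obtain B where B: "finite B" "B \<subseteq> G" and span: "\<forall>f\<in>G. \<exists>a. f = (\<lambda>t. \<Sum>b\<in>B. a b * b t)"
    by (rule finite_spanning_subset[OF H \<open>finite X\<close> nodes \<open>G \<subseteq> H\<close>])
  have "\<exists>\<rho>. (\<forall>i. periodic_fun_simple' (\<rho> i) \<and> real_analytic (\<rho> i)) \<and>
      b = (\<lambda>t. exp (\<mu> * of_real t) * (\<Sum>i<m. (of_real t gchoose i) * \<rho> i t))" if "b \<in> B" for b
    using generalized_eigenfunction_expansion[OF z, of b m] that B(2) analytic by (auto simp: G_def)
  then obtain \<rho> where per: "\<And>b i. b \<in> B \<Longrightarrow> periodic_fun_simple' (\<rho> b i) \<and> real_analytic (\<rho> b i)"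
    and expand: "\<And>b. b \<in> B \<Longrightarrow> b = (\<lambda>t. exp (\<mu> * of_real t) * (\<Sum>i<m. (of_real t gchoose i) * \<rho> b i t))"
    by metis
  define I where "I = B \<times> {..<m}"
  have "finite I"
    using B(1) by (simp add: I_def)
  define \<sigma> where "\<sigma> = (\<lambda>(b, i). \<rho> b i)"
  obtain d \<pi> where \<pi>: "\<forall>k. \<pi> k \<in> insert (\<lambda>t. 0) (\<sigma> ` I)"
    and pack: "\<forall>p. (\<forall>i\<in>I. degree (p i) \<le> m) \<longrightarrow>
      (\<exists>q\<in>poly_tuples d. \<forall>t. (\<Sum>k=0..d. poly (q k) (of_real t) * \<pi> k t)
        = (\<Sum>i\<in>I. poly (p i) (of_real t) * \<sigma> i t))"
    by (rule pack_into_tuple[OF \<open>finite I\<close>])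
  have "periodic_fun_simple' (\<pi> k) \<and> real_analytic (\<pi> k)" for k
    using spec[OF \<pi>, of k] per real_analytic_const[of 0]
    by (auto simp: I_def \<sigma>_def periodic_fun_simple'_def)
  moreover have "f \<in> exp_poly \<mu> d \<pi> ` poly_tuples d" if f: "f \<in> G" for f
  proof -
    obtain c where c: "f = (\<lambda>t. \<Sum>b\<in>B. c b * b t)"
      using span f by blast
    define p where "p = (\<lambda>(b, i). smult (c b) (binomial_poly i))"
    have "degree (p (b, i)) \<le> m" if "i < m" for b i
      using degree_smult_le[of "c b" "binomial_poly i"] degree_binomial_poly[of i] that
      by (simp add: p_def)
    then have "\<forall>i\<in>I. degree (p i) \<le> m"
      by (auto simp: I_def)
    from mp[OF spec[OF pack] this] obtain q where q: "q \<in> poly_tuples d"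
      and sums: "\<And>t. (\<Sum>k=0..d. poly (q k) (of_real t) * \<pi> k t)
        = (\<Sum>i\<in>I. poly (p i) (of_real t) * \<sigma> i t)"
      by auto
    have "f t = exp_poly \<mu> d \<pi> q t" for t
    proof -
      have "f t = (\<Sum>b\<in>B. c b * (exp (\<mu> * of_real t) * (\<Sum>i<m. (of_real t gchoose i) * \<rho> b i t)))"
        unfolding c by (intro sum.cong refl) (metis expand)
      also have "\<dots> = exp (\<mu> * of_real t) * (\<Sum>b\<in>B. \<Sum>i<m. c b * (of_real t gchoose i) * \<rho> b i t)"
        unfolding sum_distrib_left by (intro sum.cong refl) (simp only: mult_ac)
      also have "\<dots> = exp_poly \<mu> d \<pi> q t"
        by (simp add: exp_poly_def sums I_def p_def \<sigma>_def sum.cartesian_product poly_binomial_poly split_def)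
      finally show ?thesis .
    qed
    then show ?thesis
      using q by blast
  qed
  ultimately show ?thesis
    unfolding G_def[symmetric] by (intro exI[of _ d] exI[of _ \<pi>]) auto
qed

text \<open>
  Shifting a tuple corresponds to shifting its function and multiplying by \<open>exp (- \<mu>)\<close>, because the
  \<open>\<pi> k\<close> are periodic. So the tuples with function in a shift-invariant space are invariant.
\<close>

lemma invariant_tuple_subspace_preimage:
  assumes U: "cfun.subspace U" and shift: "\<And>g. g \<in> U \<Longrightarrow> (\<lambda>t. g (t + 1)) \<in> U"
    and per: "\<And>k. periodic_fun_simple' (\<pi> k)"
  shows "invariant_tuple_subspace d {p \<in> poly_tuples d. exp_poly \<mu> d \<pi> p \<in> U}"
  unfolding invariant_tuple_subspace_def
proof (intro conjI)
  have add: "exp_poly \<mu> d \<pi> (p + q) = exp_poly \<mu> d \<pi> p + exp_poly \<mu> d \<pi> q" for p q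
    by (simp add: exp_poly_def fun_eq_iff ring_distribs sum.distrib)
  have scale: "exp_poly \<mu> d \<pi> (scale_tuple c p) = scale_fun c (exp_poly \<mu> d \<pi> p)" for c p
    by (simp add: exp_poly_def scale_tuple_def scale_fun_def fun_eq_iff sum_distrib_left mult_ac)
  have zero: "exp_poly \<mu> d \<pi> 0 = 0"
    by (simp add: exp_poly_def fun_eq_iff)
  show "ctuple.subspace {p \<in> poly_tuples d. exp_poly \<mu> d \<pi> p \<in> U}"
  proof (rule ctuple.subspaceI)
    show "0 \<in> {p \<in> poly_tuples d. exp_poly \<mu> d \<pi> p \<in> U}"
      using cfun.subspace_0[OF U] by (simp add: zero poly_tuples_def)
  next
    fix p q assume "p \<in> {p \<in> poly_tuples d. exp_poly \<mu> d \<pi> p \<in> U}"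
      "q \<in> {p \<in> poly_tuples d. exp_poly \<mu> d \<pi> p \<in> U}"
    then show "p + q \<in> {p \<in> poly_tuples d. exp_poly \<mu> d \<pi> p \<in> U}"
      using cfun.subspace_add[OF U] add[of p q] by (auto simp: poly_tuples_def intro: degree_add_le)
  next
    fix c p assume "p \<in> {p \<in> poly_tuples d. exp_poly \<mu> d \<pi> p \<in> U}"
    then show "scale_tuple c p \<in> {p \<in> poly_tuples d. exp_poly \<mu> d \<pi> p \<in> U}"
      using cfun.subspace_scale[OF U] scale[of c p]
      by (auto simp: poly_tuples_def scale_tuple_def intro: order.trans[OF degree_smult_le])
  qed
  have "exp_poly \<mu> d \<pi> (tuple_shift p)
      = scale_fun (exp (-\<mu>)) (\<lambda>t. exp_poly \<mu> d \<pi> p (t + 1))" for p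
  proof
    fix t
    have "\<pi> k (t + 1) = \<pi> k t" for k
      using per[of k] by (simp add: periodic_fun_simple'_def)
    moreover have "exp (\<mu> * of_real t) = exp (-\<mu>) * exp (\<mu> * of_real (t + 1))"
      by (simp add: exp_minus exp_add ring_distribs)
    ultimately show "exp_poly \<mu> d \<pi> (tuple_shift p) t
        = scale_fun (exp (-\<mu>)) (\<lambda>t. exp_poly \<mu> d \<pi> p (t + 1)) t"
      by (simp add: exp_poly_def tuple_shift_def scale_fun_def poly_pcompose add_ac)
  qed
  moreover have "tuple_shift p \<in> poly_tuples d" if "p \<in> poly_tuples d" for p
    using that by (auto simp: poly_tuples_def tuple_shift_def degree_pcompose)
  ultimately show "tuple_shift ` {p \<in> poly_tuples d. exp_poly \<mu> d \<pi> p \<in> U}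
      \<subseteq> {p \<in> poly_tuples d. exp_poly \<mu> d \<pi> p \<in> U}"
    using cfun.subspace_scale[OF U] shift by auto
qed auto

section \<open>Spaces spanned by translates of compactly supported generators\<close>

lemma compactly_supported_bound:
  assumes "compactly_supported f"
  obtains K where "\<And>t. f t \<noteq> 0 \<Longrightarrow> \<bar>t\<bar> \<le> K"
proof -
  have "bounded (closure (support_on UNIV f))"
    using assms by (simp add: compactly_supported_def compact_imp_bounded)
  then obtain K where K: "\<And>t. t \<in> closure (support_on UNIV f) \<Longrightarrow> \<bar>t\<bar> \<le> K"
    by (auto simp: bounded_iff)
  show ?thesis
  proof (rule that)
    fix t assume "f t \<noteq> 0"
    then have "t \<in> support_on UNIV f"
      by (simp add: support_on_def)
    then show "\<bar>t\<bar> \<le> K"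
      using K closure_subset by blast
  qed
qed

text \<open>
  This makes the infinite sums of translates pointwise finite, so they are summable and additive in
  the coefficients.
\<close>

lemma finite_overlap:
  assumes "compactly_supported f"
  shows "finite {k::int. f (t - of_int k) \<noteq> 0}"
proof -
  obtain K where K: "\<And>t. f t \<noteq> 0 \<Longrightarrow> \<bar>t\<bar> \<le> K"
    using compactly_supported_bound[OF assms] by blast
  have bounded: "k \<in> {\<lfloor>t - K\<rfloor>..\<lceil>t + K\<rceil>}" if "f (t - of_int k) \<noteq> 0" for k
  proof -
    have "t - K \<le> of_int k" "of_int k \<le> t + K"
      using K[OF that] by auto
    then show ?thesis
      by (simp add: floor_le_iff le_ceiling_iff)
  qed
  have "{k. f (t - of_int k) \<noteq> 0} \<subseteq> {\<lfloor>t - K\<rfloor>..\<lceil>t + K\<rceil>}"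
    using bounded by blast
  then show ?thesis
    by (rule finite_subset) (rule finite_atLeastAtMost_int)
qed

definition generator_sum :: "nat \<Rightarrow> (nat \<Rightarrow> real \<Rightarrow> complex) \<Rightarrow> (nat \<Rightarrow> int \<Rightarrow> complex) \<Rightarrow> real \<Rightarrow> complex"
  where "generator_sum n \<phi> c = (\<lambda>t. \<Sum>j=1..n. \<Sum>\<^sub>\<infinity>k\<in>UNIV. c j k * \<phi> j (t - of_int k))"

lemma shift_invariant_space_eq_closure:
  "shift_invariant_space n \<phi> = closure (range (generator_sum n \<phi>))"
  unfolding shift_invariant_space_def generator_sum_def by (simp add: full_SetCompr_eq)

lemma translate_summable:
  assumes "compactly_supported f"
  shows "(\<lambda>k::int. c k * f (t - of_int k)) summable_on UNIV"
proof (rule finite_nonzero_values_imp_summable_on)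
  show "finite {k \<in> UNIV. c k * f (t - of_int k) \<noteq> 0}"
    by (rule finite_subset[OF _ finite_overlap[OF assms, of t]]) auto
qed

lemma generator_sum_add:
  assumes "\<And>j. j \<in> {1..n} \<Longrightarrow> compactly_supported (\<phi> j)"
  shows "generator_sum n \<phi> (\<lambda>j k. c j k + d j k) = generator_sum n \<phi> c + generator_sum n \<phi> d"
proof
  fix t
  have "(\<Sum>\<^sub>\<infinity>k\<in>UNIV. (c j k + d j k) * \<phi> j (t - of_int k))
      = (\<Sum>\<^sub>\<infinity>k\<in>UNIV. c j k * \<phi> j (t - of_int k)) + (\<Sum>\<^sub>\<infinity>k\<in>UNIV. d j k * \<phi> j (t - of_int k))"
    if "j \<in> {1..n}" for j
    unfolding ring_distribs by (intro infsum_add translate_summable assms that)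
  then show "generator_sum n \<phi> (\<lambda>j k. c j k + d j k) t = (generator_sum n \<phi> c + generator_sum n \<phi> d) t"
    by (simp add: generator_sum_def sum.distrib)
qed

lemma generator_sum_scale:
  "generator_sum n \<phi> (\<lambda>j k. a * c j k) = scale_fun a (generator_sum n \<phi> c)"
  by (simp add: generator_sum_def scale_fun_def mult.assoc infsum_cmult_right' sum_distrib_left)

lemma generator_sum_translate:
  "(\<lambda>t. generator_sum n \<phi> c (t - of_int m)) = generator_sum n \<phi> (\<lambda>j k. c j (k - m))"
proof
  fix t
  have "(\<Sum>\<^sub>\<infinity>k\<in>UNIV. c j k * \<phi> j (t - of_int m - of_int k))
      = (\<Sum>\<^sub>\<infinity>k\<in>UNIV. c j (k - m) * \<phi> j (t - of_int k))" for j
  proof -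
    have "bij_betw (\<lambda>k. k - m) UNIV UNIV"
      by (rule bij_betwI[of _ _ _ "\<lambda>k. k + m"]) auto
    from infsum_reindex_bij_betw[OF this, of "\<lambda>k. c j k * \<phi> j (t - of_int m - of_int k)"]
    show ?thesis
      by simp
  qed
  then show "generator_sum n \<phi> c (t - of_int m) = generator_sum n \<phi> (\<lambda>j k. c j (k - m)) t"
    by (simp add: generator_sum_def)
qed

text \<open>
  The linear structure and the shifts pass to the closure because they are continuous for pointwise
  convergence.
\<close>

lemma closure_invariant:
  assumes "continuous_on UNIV T" "\<And>f. f \<in> V \<Longrightarrow> T f \<in> closure V" "f \<in> closure V"
  shows "T f \<in> closure V"
proof -
  have "T ` closure V \<subseteq> closure V"
    using assms(2) by (intro image_closure_subset continuous_on_subset[OF assms(1)]) auto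
  then show ?thesis
    using assms(3) by blast
qed

lemma continuous_on_coordinate: "continuous_on UNIV (\<lambda>f :: real \<Rightarrow> complex. f x)"
  by (rule continuous_on_product_coordinates)

text \<open>
  Addition is handled one argument at a time, since only translations by a fixed function are maps
  on the space to which the preceding lemma applies.
\<close>

lemma subspace_closure:
  assumes V: "cfun.subspace V"
  shows "cfun.subspace (closure V)"
proof (rule cfun.subspaceI)
  show "0 \<in> closure V"
    using cfun.subspace_0[OF V] closure_subset by blast
next
  have cont: "continuous_on UNIV (\<lambda>f. f + g)" for g :: "real \<Rightarrow> complex"
    unfolding plus_fun_def
    by (intro continuous_on_coordinatewise_then_product continuous_intros continuous_on_coordinate)
  have add_V: "f + g \<in> closure V" if "f \<in> closure V" "g \<in> V" for f g
    by (rule closure_invariant[OF cont _ that(1)])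
      (use cfun.subspace_add[OF V _ that(2)] closure_subset in blast)
  fix f g assume f: "f \<in> closure V" and g: "g \<in> closure V"
  have "g + f \<in> closure V"
    by (rule closure_invariant[OF cont _ g]) (subst add.commute, rule add_V[OF f])
  then show "f + g \<in> closure V"
    by (simp only: add.commute)
next
  fix c f assume f: "f \<in> closure V"
  have "continuous_on UNIV (scale_fun c)"
    unfolding scale_fun_def
    by (intro continuous_on_coordinatewise_then_product continuous_intros continuous_on_coordinate)
  then show "scale_fun c f \<in> closure V"
    by (rule closure_invariant[OF _ _ f]) (use cfun.subspace_scale[OF V] closure_subset in blast)
qed

lemma shift_invariant_closure:
  assumes "shift_invariant V"
  shows "shift_invariant (closure V)"
  unfolding shift_invariant_def
proof (intro ballI allI)
  fix f and k :: int assume f: "f \<in> closure V"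
  have "continuous_on UNIV (\<lambda>(f :: real \<Rightarrow> complex) t. f (t - of_int k))"
    by (intro continuous_on_coordinatewise_then_product continuous_on_coordinate)
  then show "(\<lambda>t. f (t - of_int k)) \<in> closure V"
    by (rule closure_invariant[OF _ _ f]) (use assms closure_subset in \<open>auto simp: shift_invariant_def\<close>)
qed

lemma
  assumes "\<And>j. j \<in> {1..n} \<Longrightarrow> compactly_supported (\<phi> j)"
  shows subspace_shift_invariant_space: "cfun.subspace (shift_invariant_space n \<phi>)"
    and shift_invariant_shift_invariant_space: "shift_invariant (shift_invariant_space n \<phi>)"
proof -
  have "cfun.subspace (range (generator_sum n \<phi>))"
  proof (rule cfun.subspaceI)
    have "generator_sum n \<phi> (\<lambda>j k. 0) = 0"
      by (simp add: generator_sum_def fun_eq_iff)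
    then show "0 \<in> range (generator_sum n \<phi>)"
      using rangeI[of "generator_sum n \<phi>" "\<lambda>j k. 0"] by (simp only:)
  next
    fix f g assume "f \<in> range (generator_sum n \<phi>)" "g \<in> range (generator_sum n \<phi>)"
    then obtain c d where "f = generator_sum n \<phi> c" "g = generator_sum n \<phi> d"
      by (elim rangeE)
    then have "generator_sum n \<phi> (\<lambda>j k. c j k + d j k) = f + g"
      by (simp only: generator_sum_add[OF assms])
    then show "f + g \<in> range (generator_sum n \<phi>)"
      using rangeI[of "generator_sum n \<phi>" "\<lambda>j k. c j k + d j k"] by (simp only:)
  next
    fix a f assume "f \<in> range (generator_sum n \<phi>)"
    then obtain c where "f = generator_sum n \<phi> c"
      by (rule rangeE)
    then have "generator_sum n \<phi> (\<lambda>j k. a * c j k) = scale_fun a f"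
      by (simp only: generator_sum_scale)
    then show "scale_fun a f \<in> range (generator_sum n \<phi>)"
      using rangeI[of "generator_sum n \<phi>" "\<lambda>j k. a * c j k"] by (simp only:)
  qed
  then show "cfun.subspace (shift_invariant_space n \<phi>)"
    unfolding shift_invariant_space_eq_closure by (rule subspace_closure)
  have "shift_invariant (range (generator_sum n \<phi>))"
    by (auto simp: shift_invariant_def generator_sum_translate)
  then show "shift_invariant (shift_invariant_space n \<phi>)"
    unfolding shift_invariant_space_eq_closure by (rule shift_invariant_closure)
qed

text \<open>
  Only the translates by \<open>k \<in> {-L..L}\<close> reach the interval \<open>(0,1)\<close>, when \<open>L\<close> exceeds the radius of all
  supports by at least 1.
\<close>

lemma shift_invariant_space_nodes:
  assumes "\<And>j. j \<in> {1..n} \<Longrightarrow> compactly_supported (\<phi> j)"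
  obtains X where "finite X"
    "shift_invariant_space n \<phi> \<inter> vanishing_on X \<subseteq> vanishing_on {0<..<1}"
proof -
  have "\<forall>j\<in>{1..n}. \<exists>K. \<forall>t. \<phi> j t \<noteq> 0 \<longrightarrow> \<bar>t\<bar> \<le> K"
  proof
    fix j assume "j \<in> {1..n}"
    then obtain K where "\<And>t. \<phi> j t \<noteq> 0 \<Longrightarrow> \<bar>t\<bar> \<le> K"
      using compactly_supported_bound[OF assms] by blast
    then show "\<exists>K. \<forall>t. \<phi> j t \<noteq> 0 \<longrightarrow> \<bar>t\<bar> \<le> K"
      by (intro exI[of _ K] allI impI)
  qed
  from bchoice[OF this] obtain K where "\<forall>j\<in>{1..n}. \<forall>t. \<phi> j t \<noteq> 0 \<longrightarrow> \<bar>t\<bar> \<le> K j"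
    by (rule exE)
  then have K: "\<bar>t\<bar> \<le> K j" if "j \<in> {1..n}" "\<phi> j t \<noteq> 0" for j t
    using that by blast
  define L where "L = \<lceil>Max (insert 0 (K ` {1..n}))\<rceil> + 1"
  have L: "k \<in> {-L..L}" if j: "j \<in> {1..n}" and t: "t \<in> {0<..<1}" and "\<phi> j (t - of_int k) \<noteq> 0" for j t k
  proof -
    have "K j \<le> Max (insert 0 (K ` {1..n}))"
      using j by (intro Max_ge) auto
    then have "K j + 1 \<le> of_int L"
      unfolding L_def by linarith
    moreover have "\<bar>t - of_int k\<bar> \<le> K j"
      by (rule K) fact+
    ultimately have "- real_of_int L \<le> of_int k" "real_of_int k \<le> of_int L"
      using t by auto
    then show ?thesis by simp
  qed
  define I where "I = {1..n} \<times> {-L..L}"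
  have "finite I" by (simp add: I_def)
  have rep: "generator_sum n \<phi> c t = (\<Sum>i\<in>I. c (fst i) (snd i) * \<phi> (fst i) (t - of_int (snd i)))"
    if t: "t \<in> {0<..<1}" for c t
  proof -
    have "(\<Sum>\<^sub>\<infinity>k\<in>UNIV. c j k * \<phi> j (t - of_int k)) = (\<Sum>k\<in>{-L..L}. c j k * \<phi> j (t - of_int k))"
      if "j \<in> {1..n}" for j
    proof -
      have vanish: "\<phi> j (t - of_int k) = 0" if "k \<in> UNIV - {-L..L}" for k
        using L[OF \<open>j \<in> {1..n}\<close> t, of k] that by blast
      have "(\<Sum>\<^sub>\<infinity>k\<in>UNIV. c j k * \<phi> j (t - of_int k)) = (\<Sum>\<^sub>\<infinity>k\<in>{-L..L}. c j k * \<phi> j (t - of_int k))"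
        by (rule infsum_cong_neutral) (simp_all only: vanish mult_zero_right Diff_UNIV empty_iff)
      then show ?thesis by simp
    qed
    then have "generator_sum n \<phi> c t = (\<Sum>j=1..n. \<Sum>k\<in>{-L..L}. c j k * \<phi> j (t - of_int k))"
      unfolding generator_sum_def by (rule sum.cong[OF refl])
    then show ?thesis
      by (simp only: I_def sum.cartesian_product split_def)
  qed
  have combination: "\<exists>c. \<forall>t\<in>{0<..<1}. f t = (\<Sum>i\<in>I. c i * \<phi> (fst i) (t - of_int (snd i)))"
    if f: "f \<in> range (generator_sum n \<phi>)" for f
  proof -
    obtain c where "f = generator_sum n \<phi> c"
      using f by (rule rangeE)
    then show ?thesis
      using rep by (intro exI[of _ "\<lambda>i. c (fst i) (snd i)"]) simp
  qed
  show ?thesis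
  proof (rule finite_interpolation_nodes[OF \<open>finite I\<close> combination])
    fix X assume "finite X" "closure (range (generator_sum n \<phi>)) \<inter> vanishing_on X \<subseteq> vanishing_on {0<..<1}"
    then show ?thesis
      by (intro that[of X]) (simp_all only: shift_invariant_space_eq_closure)
  qed
qed

section \<open>The decomposition theorem\<close>

text \<open>
  The number 1 joins the roots so that the index set is nonempty even when \<open>Q\<close> is constant. If it is
  not a root, its factor has exponent 0.
\<close>

lemma prod_linear_factors_annihilates:
  assumes "poly Q 0 \<noteq> 0" "shift_op Q f = (\<lambda>t. 0)"
  shows "shift_op (\<Prod>z\<in>insert 1 {z. poly Q z = 0}. [:-z, 1:] ^ order z Q) f = (\<lambda>t. 0)"
proof
  fix t
  have "Q \<noteq> 0"
    using assms(1) by auto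
  then have fin: "finite {z. poly Q z = 0}"
    by (rule poly_roots_finite)
  have "(\<Prod>z\<in>insert 1 {z. poly Q z = 0}. [:-z, 1:] ^ order z Q)
      = (\<Prod>z | poly Q z = 0. [:-z, 1:] ^ order z Q)"
  proof (rule prod.mono_neutral_right)
    show "\<forall>z\<in>insert 1 {z. poly Q z = 0} - {z. poly Q z = 0}. [:-z, 1:] ^ order z Q = 1"
      by (simp add: order_0I)
  qed (use fin in auto)
  moreover have "lead_coeff Q * shift_op (\<Prod>z | poly Q z = 0. [:-z, 1:] ^ order z Q) f t = 0"
    by (simp only: complex_poly_decompose assms(2) flip: shift_op_smult)
  ultimately show "shift_op (\<Prod>z\<in>insert 1 {z. poly Q z = 0}. [:-z, 1:] ^ order z Q) f t = 0"
    using \<open>Q \<noteq> 0\<close> by simp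
qed

lemma exp_eq_if_diff_multiple:
  assumes "\<mu> - \<nu> = of_int m * (2 * of_real pi * \<i>)"
  shows "exp \<mu> = exp \<nu>"
  using assms by (auto simp: exp_eq algebra_simps intro!: exI[of _ m])

text \<open>
  The tuple spaces are as large as possible: all tuples whose function lies in \<open>U\<close>. Their functions
  lie in \<open>U\<close> by construction, and they include all generalized eigenfunctions in \<open>U\<close>, which span
  \<open>U\<close>.
\<close>

lemma span_exp_poly_spaces:
  fixes s :: nat
  assumes U: "cfun.subspace U" and shift: "shift_invariant U"
    and Z: "bij_betw \<zeta> {1..s} Z"
    and kill: "\<And>f. f \<in> U \<Longrightarrow> shift_op (\<Prod>z\<in>Z. [:-z, 1:] ^ m z) f = (\<lambda>t. 0)"
    and cover: "\<And>j. j \<in> {1..s} \<Longrightarrow> {f \<in> U. shift_op ([:-\<zeta> j, 1:] ^ m (\<zeta> j)) f = (\<lambda>t. 0)}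
      \<subseteq> exp_poly (\<mu> j) (d j) (\<pi> j) ` poly_tuples (d j)"
  shows "U = cfun.span (\<Union>j\<in>{1..s}. exp_poly_space (\<mu> j) (d j) (\<pi> j)
    {p \<in> poly_tuples (d j). exp_poly (\<mu> j) (d j) (\<pi> j) p \<in> U})"
    (is "U = cfun.span ?L")
proof
  have "?L \<subseteq> U"
    by (auto simp: exp_poly_space_eq_image)
  then show "cfun.span ?L \<subseteq> U"
    by (rule cfun.span_minimal[OF _ U])
  have "finite Z"
    using bij_betw_finite[OF Z] by simp
  have "(\<Union>z\<in>Z. {g \<in> U. shift_op ([:-z, 1:] ^ m z) g = (\<lambda>t. 0)}) \<subseteq> ?L"
  proof (rule UN_least)
    fix z assume "z \<in> Z"
    then obtain j where j: "j \<in> {1..s}" "\<zeta> j = z"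
      using Z by (auto simp: bij_betw_def)
    then have "{g \<in> U. shift_op ([:-z, 1:] ^ m z) g = (\<lambda>t. 0)}
        \<subseteq> exp_poly_space (\<mu> j) (d j) (\<pi> j) {p \<in> poly_tuples (d j). exp_poly (\<mu> j) (d j) (\<pi> j) p \<in> U}"
      using cover[OF j(1)] by (auto simp: exp_poly_space_eq_image)
    then show "{g \<in> U. shift_op ([:-z, 1:] ^ m z) g = (\<lambda>t. 0)} \<subseteq> ?L"
      using j(1) by blast
  qed
  then have "cfun.span (\<Union>z\<in>Z. {g \<in> U. shift_op ([:-z, 1:] ^ m z) g = (\<lambda>t. 0)}) \<subseteq> cfun.span ?L"
    by (rule cfun.span_mono)
  moreover have "f \<in> cfun.span (\<Union>z\<in>Z. {g \<in> U. shift_op ([:-z, 1:] ^ m z) g = (\<lambda>t. 0)})" if "f \<in> U" for f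
    by (rule primary_decomposition[OF U shift_invariantD_add1[OF shift] \<open>finite Z\<close> that kill[OF that]])
  ultimately show "U \<subseteq> cfun.span ?L"
    by blast
qed

theorem theorem2p8:
  fixes n :: nat and \<phi> :: "nat \<Rightarrow> real \<Rightarrow> complex" and H :: "(real \<Rightarrow> complex) set"
  assumes "\<And>j. j \<in> {1..n} \<Longrightarrow> compactly_supported (\<phi> j)"
    and "H = {f \<in> shift_invariant_space n \<phi>. real_analytic f}"
  shows "\<exists>(s::nat) (\<mu> :: nat \<Rightarrow> complex) (d :: nat \<Rightarrow> nat) (\<pi> :: nat \<Rightarrow> nat \<Rightarrow> real \<Rightarrow> complex)
            (N :: nat \<Rightarrow> (nat \<Rightarrow> complex poly) set).
      s \<ge> 1 \<and>
      (\<forall>i\<in>{1..s}. \<forall>j\<in>{1..s}. i \<noteq> j \<longrightarrow>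
         \<not> (\<exists>m::int. \<mu> i - \<mu> j = of_int m * (2 * of_real pi * \<i>))) \<and>
      (\<forall>j\<in>{1..s}. \<forall>k\<in>{0..d j}. periodic_fun_simple' (\<pi> j k) \<and> real_analytic (\<pi> j k)) \<and>
      (\<forall>j\<in>{1..s}. invariant_tuple_subspace (d j) (N j)) \<and>
      H = cfun.span (\<Union>j\<in>{1..s}. exp_poly_space (\<mu> j) (d j) (\<pi> j) (N j)) \<and>
      (\<forall>H'. cfun.subspace H' \<and> H' \<subseteq> H \<and> shift_invariant H' \<longrightarrow>
         (\<exists>N' :: nat \<Rightarrow> (nat \<Rightarrow> complex poly) set.
            (\<forall>j\<in>{1..s}. N' j \<subseteq> N j \<and> invariant_tuple_subspace (d j) (N' j)) \<and>
            H' = cfun.span (\<Union>j\<in>{1..s}. exp_poly_space (\<mu> j) (d j) (\<pi> j) (N' j))))"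
proof -
  note V_subspace = subspace_shift_invariant_space[of n \<phi>, OF assms(1)]
  note V_shift = shift_invariant_shift_invariant_space[of n \<phi>, OF assms(1)]
  have "H = shift_invariant_space n \<phi> \<inter> {f. real_analytic f}"
    using assms(2) by blast
  then have H: "cfun.subspace H"
    by (simp only: cfun.subspace_inter[OF V_subspace subspace_real_analytic])
  have analytic: "real_analytic f" if "f \<in> H" for f
    using that assms(2) by simp
  have shift: "shift_invariant H"
    unfolding shift_invariant_def
  proof (intro ballI allI)
    fix f and k :: int assume f: "f \<in> H"
    then have "(\<lambda>t. f (t - of_int k)) \<in> shift_invariant_space n \<phi>"
      using V_shift assms(2) by (simp add: shift_invariant_def)
    moreover have "real_analytic (\<lambda>t. f (t - of_int k))"
      using real_analytic_translate[OF analytic[OF f], of "- of_int k"] by simp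
    ultimately show "(\<lambda>t. f (t - of_int k)) \<in> H"
      using assms(2) by simp
  qed
  obtain X where "finite X" and X: "shift_invariant_space n \<phi> \<inter> vanishing_on X \<subseteq> vanishing_on {0<..<1}"
    by (rule shift_invariant_space_nodes[of n \<phi>, OF assms(1)])
  have nodes: "H \<inter> vanishing_on X \<subseteq> {\<lambda>t. 0}"
  proof
    fix f assume f: "f \<in> H \<inter> vanishing_on X"
    then have "f \<in> vanishing_on {0<..<1}"
      using X assms(2) by blast
    then have "f t = 0" for t
      using real_analytic_eq_0[of f 0 1 t] analytic[of f] f by (simp add: vanishing_on_def)
    then show "f \<in> {\<lambda>t. 0}"
      by (simp add: fun_eq_iff)
  qed
  obtain Q where Q0: "poly Q 0 \<noteq> 0" and Q: "\<forall>f\<in>H. shift_op Q f = (\<lambda>t. 0)"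
    by (rule annihilating_polynomial[OF H shift \<open>finite X\<close> nodes])
  define Z where "Z = insert 1 {z. poly Q z = 0}"
  define s where "s = card Z"
  have "finite Z"
    unfolding Z_def using Q0 by (intro finite.insertI poly_roots_finite) auto
  then have "s \<ge> 1"
    by (simp add: s_def Suc_le_eq card_gt_0_iff Z_def)
  obtain \<zeta> where \<zeta>: "bij_betw \<zeta> {1..s} Z"
    using ex_bij_betw_nat_finite_1[OF \<open>finite Z\<close>] unfolding s_def by (rule exE)
  define \<mu> where "\<mu> j = Ln (\<zeta> j)" for j
  have exp_\<mu>: "exp (\<mu> j) = \<zeta> j" if "j \<in> {1..s}" for j
  proof -
    have "\<zeta> j \<in> Z"
      using bij_betwE[OF \<zeta>] that by blast
    then have "\<zeta> j \<noteq> 0"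
      using Q0 by (auto simp: Z_def)
    then show ?thesis
      by (simp add: \<mu>_def)
  qed
  have distinct: "\<not> (\<exists>m::int. \<mu> i - \<mu> j = of_int m * (2 * of_real pi * \<i>))"
    if "i \<in> {1..s}" "j \<in> {1..s}" "i \<noteq> j" for i j
  proof
    assume "\<exists>m::int. \<mu> i - \<mu> j = of_int m * (2 * of_real pi * \<i>)"
    then have "\<zeta> i = \<zeta> j"
      using exp_eq_if_diff_multiple exp_\<mu> that by metis
    then show False
      using inj_on_eq_iff[OF bij_betw_imp_inj_on[OF \<zeta>] that(1,2)] that(3) by simp
  qed
  have "\<forall>j\<in>{1..s}. \<exists>d \<pi>. (\<forall>k. periodic_fun_simple' (\<pi> k) \<and> real_analytic (\<pi> k)) \<and>
      {f \<in> H. shift_op ([:-\<zeta> j, 1:] ^ order (\<zeta> j) Q) f = (\<lambda>t. 0)} \<subseteq> exp_poly (\<mu> j) d \<pi> ` poly_tuples d"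
    by (intro ballI generalized_eigenspace_exp_poly[OF H \<open>finite X\<close> nodes] analytic exp_\<mu>)
  from bchoice[OF this] obtain d where "\<forall>j\<in>{1..s}. \<exists>\<pi>.
      (\<forall>k. periodic_fun_simple' (\<pi> k) \<and> real_analytic (\<pi> k)) \<and>
      {f \<in> H. shift_op ([:-\<zeta> j, 1:] ^ order (\<zeta> j) Q) f = (\<lambda>t. 0)}
        \<subseteq> exp_poly (\<mu> j) (d j) \<pi> ` poly_tuples (d j)"
    by (rule exE)
  from bchoice[OF this] obtain \<pi> where \<pi>: "\<forall>j\<in>{1..s}.
      (\<forall>k. periodic_fun_simple' (\<pi> j k) \<and> real_analytic (\<pi> j k)) \<and>
      {f \<in> H. shift_op ([:-\<zeta> j, 1:] ^ order (\<zeta> j) Q) f = (\<lambda>t. 0)}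
        \<subseteq> exp_poly (\<mu> j) (d j) (\<pi> j) ` poly_tuples (d j)"
    by (rule exE)
  \<comment> \<open>The same \<open>\<mu>\<close>, \<open>d\<close> and \<open>\<pi>\<close> serve for every shift-invariant subspace \<open>U\<close> of \<open>H\<close>.\<close>
  define N where "N U j = {p \<in> poly_tuples (d j). exp_poly (\<mu> j) (d j) (\<pi> j) p \<in> U}" for U j
  have invariant: "invariant_tuple_subspace (d j) (N U j)"
    if "cfun.subspace U" "shift_invariant U" "j \<in> {1..s}" for U j
    unfolding N_def
    by (rule invariant_tuple_subspace_preimage[OF that(1) shift_invariantD_add1[OF that(2)]])
      (use \<pi> that(3) in simp_all)
  have span: "U = cfun.span (\<Union>j\<in>{1..s}. exp_poly_space (\<mu> j) (d j) (\<pi> j) (N U j))"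
    if U: "cfun.subspace U" "shift_invariant U" "U \<subseteq> H" for U
    unfolding N_def
  proof (rule span_exp_poly_spaces[OF U(1,2) \<zeta>])
    show "shift_op (\<Prod>z\<in>Z. [:-z, 1:] ^ order z Q) f = (\<lambda>t. 0)" if "f \<in> U" for f
      unfolding Z_def by (rule prod_linear_factors_annihilates[OF Q0]) (use Q U(3) that in blast)
    show "{f \<in> U. shift_op ([:-\<zeta> j, 1:] ^ order (\<zeta> j) Q) f = (\<lambda>t. 0)}
        \<subseteq> exp_poly (\<mu> j) (d j) (\<pi> j) ` poly_tuples (d j)" if "j \<in> {1..s}" for j
      using \<pi> that U(3) by blast
  qed
  have subspaces: "\<exists>N'. (\<forall>j\<in>{1..s}. N' j \<subseteq> N H j \<and> invariant_tuple_subspace (d j) (N' j)) \<and>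
      U = cfun.span (\<Union>j\<in>{1..s}. exp_poly_space (\<mu> j) (d j) (\<pi> j) (N' j))"
    if U: "cfun.subspace U \<and> U \<subseteq> H \<and> shift_invariant U" for U
  proof (intro exI[of _ "N U"] conjI ballI)
    show "N U j \<subseteq> N H j" for j
      using U by (auto simp: N_def)
    show "invariant_tuple_subspace (d j) (N U j)" if "j \<in> {1..s}" for j
      using U that by (intro invariant) simp_all
    show "U = cfun.span (\<Union>j\<in>{1..s}. exp_poly_space (\<mu> j) (d j) (\<pi> j) (N U j))"
      using U by (intro span) simp_all
  qed
  show ?thesis
  proof (intro exI conjI)
    show "1 \<le> s" by fact
    show "\<forall>i\<in>{1..s}. \<forall>j\<in>{1..s}. i \<noteq> j \<longrightarrow>
        \<not> (\<exists>m::int. \<mu> i - \<mu> j = of_int m * (2 * of_real pi * \<i>))"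
      by (intro ballI impI distinct)
    show "\<forall>j\<in>{1..s}. \<forall>k\<in>{0..d j}. periodic_fun_simple' (\<pi> j k) \<and> real_analytic (\<pi> j k)"
      using \<pi> by simp
    show "\<forall>j\<in>{1..s}. invariant_tuple_subspace (d j) (N H j)"
      by (intro ballI invariant H shift)
    show "H = cfun.span (\<Union>j\<in>{1..s}. exp_poly_space (\<mu> j) (d j) (\<pi> j) (N H j))"
      by (rule span[OF H shift order_refl])
    show "\<forall>H'. cfun.subspace H' \<and> H' \<subseteq> H \<and> shift_invariant H' \<longrightarrow>
         (\<exists>N' :: nat \<Rightarrow> (nat \<Rightarrow> complex poly) set.
            (\<forall>j\<in>{1..s}. N' j \<subseteq> N H j \<and> invariant_tuple_subspace (d j) (N' j)) \<and>
            H' = cfun.span (\<Union>j\<in>{1..s}. exp_poly_space (\<mu> j) (d j) (\<pi> j) (N' j)))"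
      by (intro allI impI subspaces)
  qed
qed

end
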